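(* Let $R$ be a Baer $\ast$-ring of type $I_f$ that satisfies axioms (A2), (A3), (A4), (A5) and (A6). Then $R$ is almost $\ast$-clean. If $R$ is also von Neumann regular, then $R$ is $\ast$-clean.
   Context: All rings are associative and unital. A $\ast$-ring is a ring $R$ with a map $\ast:R\to R$ with $(x+y)^\ast=x^\ast+y^\ast$, $(xy)^\ast=y^\ast x^\ast$, $(x^\ast)^\ast=x$. A projection is an element $p$ with $p^\ast=p=p^2$; projections are ordered by $p\le q$ iff $p=pq$; orthogonal means $pq=0$. A Baer $\ast$-ring is a $\ast$-ring in which the right annihilator of every nonempty subset is generated, as a right ideal, by a projection (its projections then form a complete lattice). For $x$ in such a ring, $\mathrm{RP}(x)$ is the unique projection $p$ with $xp=x$ and right annihilator of $x$ equal to $(1-p)R$. For $S\subseteq R$, $S'$ is the commutant of $S$ in $R$ and $S''=(S')'$. A partial isometry is $w$ with $ww^\ast w=w$; a unitary is $u$ with $u^\ast u=uu^\ast=1$. A ring is abelian if all its idempotents are central. A projection $p$ is abelian if the ring $pRp$ is abelian; $p$ is faithful if there is no nonzero central idempotent $e$ with $ep=0$. A Baer $\ast$-ring is finite if $x^\ast x=1$ implies $xx^\ast=1$; of type $I$ if it has a faithful abelian projection; of type $I_f$ if it is of type $I$ and finite. Axioms: (A2) consists of (EP) and (UPSR). (EP): for every $0\neq x\in R$ there is a self-adjoint $y\in\{x^\ast x\}''$ such that $(x^\ast x)y^2$ is a nonzero projection. (UPSR): call $x\in R$ positive if $x=x_1^\ast x_1+\dots+x_m^\ast x_m$ for some $m$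 and $x_1,\dots,x_m\in R$; for every positive $x$ there is a unique $y\in\{x^\ast x\}''$ such that $y^2=x$ and $y$ is positive. (A3) Partial isometries are addable: whenever $(w_i)$ is a family of partial isometries such that the projections $e_i=w_i^\ast w_i$ are pairwise orthogonal and the projections $f_i=w_iw_i^\ast$ are pairwise orthogonal, there is a partial isometry $w$ with $w^\ast w=\sup e_i$, $ww^\ast=\sup f_i$ and $we_i=w_i=f_iw$ for all $i$. (A4) $1+x^\ast x$ is invertible for all $x\in R$. (A5) There is a central $i\in R$ with $i^2=-1$ and $i^\ast=-i$. (A6) For every unitary $u\in R$ with $\mathrm{RP}(1-u)=1$ there is an increasing sequence of projections $p_n\in\{u\}''$ with $\sup p_n=1$ such that $(1-u)p_n$ is invertible in $p_nRp_n$ for every $n$. An element of a ring is regular if it is neither a left nor a right zero-divisor. A $\ast$-ring is $\ast$-clean (resp. almost $\ast$-clean) if every element is the sum of a unit (resp. a regular element) and a projection. *)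

theory Defs
  imports Main
begin

text \<open>
  Rings are types of sort \<open>{ring, monoid_mult}\<close>: associative and unital, but, unlike with
  \<open>ring_1\<close>, the zero ring is not excluded.  Notions that are also needed for a corner
  \<open>pRp\<close> are phrased for a subset of the type.
\<close>

definition commutant :: "'a::ring set \<Rightarrow> 'a set" where
  "commutant S = {y. \<forall>x\<in>S. x * y = y * x}"

abbreviation bicommutant :: "'a::ring set \<Rightarrow> 'a set" where
  "bicommutant S \<equiv> commutant (commutant S)"

definition central :: "'a::ring \<Rightarrow> bool" where
  "central z \<longleftrightarrow> (\<forall>x. z * x = x * z)"

definition right_annihilator :: "'a::ring set \<Rightarrow> 'a set" where
  "right_annihilator S = {y. \<forall>x\<in>S. x * y = 0}"

definition right_ideal_of :: "'a::ring \<Rightarrow> 'a set" where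
  "right_ideal_of a = {a * r | r. True}"

definition corner :: "'a::ring \<Rightarrow> 'a set" where
  "corner p = {p * r * p | r. True}"

definition abelian_ring_on :: "'a::ring set \<Rightarrow> bool" where
  "abelian_ring_on S \<longleftrightarrow> (\<forall>e\<in>S. e * e = e \<longrightarrow> (\<forall>x\<in>S. e * x = x * e))"

definition von_neumann_regular_on :: "'a::ring set \<Rightarrow> bool" where
  "von_neumann_regular_on S \<longleftrightarrow> (\<forall>x\<in>S. \<exists>y\<in>S. x * y * x = x)"

text \<open>The set \<open>S\<close> is a ring with identity \<open>e\<close>.\<close>

definition invertible_on :: "'a::ring set \<Rightarrow> 'a \<Rightarrow> 'a \<Rightarrow> bool" where
  "invertible_on S e x \<longleftrightarrow> x \<in> S \<and> (\<exists>y\<in>S. x * y = e \<and> y * x = e)"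

abbreviation ring_unit :: "'a::{ring,monoid_mult} \<Rightarrow> bool" where
  "ring_unit x \<equiv> invertible_on UNIV 1 x"

definition left_zero_divisor :: "'a::ring \<Rightarrow> bool" where
  "left_zero_divisor x \<longleftrightarrow> (\<exists>y. y \<noteq> 0 \<and> x * y = 0)"

definition right_zero_divisor :: "'a::ring \<Rightarrow> bool" where
  "right_zero_divisor x \<longleftrightarrow> (\<exists>y. y \<noteq> 0 \<and> y * x = 0)"

definition regular_element :: "'a::ring \<Rightarrow> bool" where
  "regular_element x \<longleftrightarrow> \<not> left_zero_divisor x \<and> \<not> right_zero_divisor x"


locale star_ring =
  fixes star :: "'a::{ring,monoid_mult} \<Rightarrow> 'a"  ("_\<^sup>\<star>" [1000] 999)
  assumes star_add: "(x + y)\<^sup>\<star> = x\<^sup>\<star> + y\<^sup>\<star>"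
    and star_mult: "(x * y)\<^sup>\<star> = y\<^sup>\<star> * x\<^sup>\<star>"
    and star_star: "(x\<^sup>\<star>)\<^sup>\<star> = x"
begin

definition projection :: "'a \<Rightarrow> bool" where
  "projection p \<longleftrightarrow> p\<^sup>\<star> = p \<and> p = p * p"

definition proj_le :: "'a \<Rightarrow> 'a \<Rightarrow> bool" where
  "proj_le p q \<longleftrightarrow> p = p * q"

text \<open>
  The supremum is taken in the poset of projections; it is unique there because
  \<open>proj_le\<close> is antisymmetric on projections.
\<close>

definition is_proj_sup :: "'a set \<Rightarrow> 'a \<Rightarrow> bool" where
  "is_proj_sup P s \<longleftrightarrow> projection s \<and> (\<forall>p\<in>P. proj_le p s) \<and>
     (\<forall>q. projection q \<longrightarrow> (\<forall>p\<in>P. proj_le p q) \<longrightarrow> proj_le s q)"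

definition RP :: "'a \<Rightarrow> 'a" where
  "RP x = (THE p. projection p \<and> x * p = x \<and> right_annihilator {x} = right_ideal_of (1 - p))"

definition partial_isometry :: "'a \<Rightarrow> bool" where
  "partial_isometry w \<longleftrightarrow> w * w\<^sup>\<star> * w = w"

definition unitary :: "'a \<Rightarrow> bool" where
  "unitary u \<longleftrightarrow> u\<^sup>\<star> * u = 1 \<and> u * u\<^sup>\<star> = 1"

definition positive :: "'a \<Rightarrow> bool" where
  "positive x \<longleftrightarrow> (\<exists>(m::nat) f. x = (\<Sum>k<m. (f k)\<^sup>\<star> * f k))"

definition abelian_projection :: "'a \<Rightarrow> bool" where
  "abelian_projection p \<longleftrightarrow> projection p \<and> abelian_ring_on (corner p)"

definition faithful_projection :: "'a \<Rightarrow> bool" where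
  "faithful_projection p \<longleftrightarrow> projection p \<and>
     \<not> (\<exists>e. e \<noteq> 0 \<and> e * e = e \<and> central e \<and> e * p = 0)"

definition finite_ring :: bool where
  "finite_ring \<longleftrightarrow> (\<forall>x. x\<^sup>\<star> * x = 1 \<longrightarrow> x * x\<^sup>\<star> = 1)"

definition type_I :: bool where
  "type_I \<longleftrightarrow> (\<exists>p. abelian_projection p \<and> faithful_projection p)"

definition type_I_f :: bool where
  "type_I_f \<longleftrightarrow> type_I \<and> finite_ring"

definition EP :: bool where
  "EP \<longleftrightarrow> (\<forall>x. x \<noteq> 0 \<longrightarrow>
     (\<exists>y. y\<^sup>\<star> = y \<and> y \<in> bicommutant {x\<^sup>\<star> * x} \<and>
       projection ((x\<^sup>\<star> * x) * y ^ 2) \<and> (x\<^sup>\<star> * x) * y ^ 2 \<noteq> 0))"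

definition UPSR :: bool where
  "UPSR \<longleftrightarrow> (\<forall>x. positive x \<longrightarrow>
     (\<exists>!y. y \<in> bicommutant {x\<^sup>\<star> * x} \<and> y ^ 2 = x \<and> positive y))"

definition axiom_A2 :: bool where
  "axiom_A2 \<longleftrightarrow> EP \<and> UPSR"

text \<open>
  A family is indexed by a subset \<open>I\<close> of the ring itself.  This covers families over arbitrary
  index sets: two equal members with distinct indices have initial projections \<open>e\<close> with
  \<open>e * e = 0\<close> and hence vanish, so the nonzero members can be indexed by themselves, and zero
  members affect neither the suprema nor the conclusion.
\<close>

definition axiom_A3 :: bool where
  "axiom_A3 \<longleftrightarrow> (\<forall>(I::'a set) (w::'a \<Rightarrow> 'a).
     (\<forall>i\<in>I. partial_isometry (w i)) \<and>
     (\<forall>i\<in>I. \<forall>j\<in>I. i \<noteq> j \<longrightarrow> ((w i)\<^sup>\<star> * w i) * ((w j)\<^sup>\<star> * w j) = 0) \<and>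
     (\<forall>i\<in>I. \<forall>j\<in>I. i \<noteq> j \<longrightarrow> (w i * (w i)\<^sup>\<star>) * (w j * (w j)\<^sup>\<star>) = 0) \<longrightarrow>
     (\<exists>v. partial_isometry v \<and>
       is_proj_sup ((\<lambda>i. (w i)\<^sup>\<star> * w i) ` I) (v\<^sup>\<star> * v) \<and>
       is_proj_sup ((\<lambda>i. w i * (w i)\<^sup>\<star>) ` I) (v * v\<^sup>\<star>) \<and>
       (\<forall>i\<in>I. v * ((w i)\<^sup>\<star> * w i) = w i \<and> w i = (w i * (w i)\<^sup>\<star>) * v)))"

definition axiom_A4 :: bool where
  "axiom_A4 \<longleftrightarrow> (\<forall>x. ring_unit (1 + x\<^sup>\<star> * x))"

definition axiom_A5 :: bool where
  "axiom_A5 \<longleftrightarrow> (\<exists>i. central i \<and> i ^ 2 = - 1 \<and> i\<^sup>\<star> = - i)"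

definition axiom_A6 :: bool where
  "axiom_A6 \<longleftrightarrow> (\<forall>u. unitary u \<and> RP (1 - u) = 1 \<longrightarrow>
     (\<exists>p :: nat \<Rightarrow> 'a.
       (\<forall>n. projection (p n) \<and> p n \<in> bicommutant {u}) \<and>
       (\<forall>n. proj_le (p n) (p (Suc n))) \<and>
       is_proj_sup (range p) 1 \<and>
       (\<forall>n. invertible_on (corner (p n)) (p n) ((1 - u) * p n))))"

definition star_clean :: bool where
  "star_clean \<longleftrightarrow> (\<forall>x. \<exists>u p. ring_unit u \<and> projection p \<and> x = u + p)"

definition almost_star_clean :: bool where
  "almost_star_clean \<longleftrightarrow> (\<forall>x. \<exists>u p. regular_element u \<and> projection p \<and> x = u + p)"

end

locale baer_star_ring = star_ring +
  assumes baer: "S \<noteq> {} \<Longrightarrow> \<exists>p. projection p \<and> right_annihilator S = right_ideal_of p"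

end

theory Submission imports Defs begin

text \<open>For a complex matrix \<open>x\<close>, let \<open>s\<close> be the projection onto the generalised kernel
  \<open>\<Union>\<^sub>k ker x\<^sup>k\<close>.  Then \<open>x - s\<close> is injective: if \<open>x v = s v\<close>, then \<open>x\<close> maps \<open>v\<close> into the generalised
  kernel, so \<open>v\<close> lies in it, \<open>s v = v\<close>, and hence \<open>x v = v\<close>; as \<open>x\<close> is nilpotent there,
  \<open>v = 0\<close>.  The same choice works in the present rings, with \<open>s\<close> the supremum of the projections
  that generate the right annihilators of the powers \<open>x\<^sup>k\<close>.  Two facts replace finite dimension.

  The first is that the kernels of the powers stabilise locally
  (\<open>kernel_stabilizes\<close>, \<open>homogeneous_parts_cover\<close>).  Let \<open>p\<close> be a faithful abelian projection.
  Below every nonzero central projection there is a nonzero central projection \<open>h\<close> that is the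
  sum of finitely many, say \<open>n\<close>, copies of \<open>h p\<close>: take a maximal orthogonal family of such copies,
  finite because the ring is finite, and cut down to a central part on which they leave no
  remainder (\<open>exists_homogeneous_part\<close>).  If \<open>h x\<^sup>n v \<noteq> 0 = h x\<^sup>n\<^sup>+\<^sup>1 v\<close>, then
  orthogonalising \<open>x\<^sup>n v, \<dots>, x v, v\<close> along the kernels of the powers, and cutting down
  by (EP), produces \<open>n + 1\<close> pairwise orthogonal equivalent nonzero projections below \<open>h\<close>.  Some
  nonzero projection \<open>k p\<close> with \<open>k\<close> central has copies in all of them; \<open>n\<close> of these copies already
  have the size of \<open>k h\<close>, and finiteness leaves no space for another (\<open>no_more_copies\<close>).

  The second is that an element with zero right annihilator has zero left
  annihilator (\<open>right_injective_imp_left_injective\<close>).  This comes from a polar decomposition: the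
  local inverses given by (EP) are glued, by addability, to a partial isometry with initial
  projection \<open>1\<close>, and finiteness makes its final projection \<open>1\<close> as well.

  In a von Neumann regular ring every regular element is a unit, which turns the almost clean
  decomposition into a clean one.\<close>

section \<open>Projections and partial isometries in a ring with involution\<close>

context star_ring
begin

lemma star_zero [simp]: "0\<^sup>\<star> = 0"
  using star_add[of 0 0] by simp

lemma star_minus [simp]: "(- x)\<^sup>\<star> = - x\<^sup>\<star>"
  using star_add[of x "- x"] by (simp add: eq_neg_iff_add_eq_0 add.commute)

lemma star_diff [simp]: "(x - y)\<^sup>\<star> = x\<^sup>\<star> - y\<^sup>\<star>"
  using star_add[of x "- y"] by simp

lemma star_one [simp]: "1\<^sup>\<star> = 1"
  using star_mult[of "1\<^sup>\<star>" 1] by (simp add: star_star)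

lemma star_sum: "(sum f A)\<^sup>\<star> = (\<Sum>i\<in>A. (f i)\<^sup>\<star>)"
  by (induction A rule: infinite_finite_induct) (auto simp: star_add)

lemma projection_star: "projection p \<Longrightarrow> p\<^sup>\<star> = p"
  by (simp add: projection_def)

lemma projection_idem: "projection p \<Longrightarrow> p * p = p"
  by (simp add: projection_def)

lemma projection_complement: "projection p \<Longrightarrow> projection (1 - p)"
  by (simp add: projection_def algebra_simps)

lemma projection_central_mult:
  "central h \<Longrightarrow> projection h \<Longrightarrow> projection p \<Longrightarrow> projection (h * p)"
  unfolding projection_def central_def by (metis mult.assoc star_mult)

text \<open>Taking adjoints, the order on projections can be tested on either side.\<close>

lemma projection_le_sym:
  assumes "projection p" "projection q"
  shows "p * q = p \<longleftrightarrow> q * p = p"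
  using assms by (metis projection_star star_mult star_star)

lemma central_complement:
  fixes h :: "'b::{ring,monoid_mult}"
  shows "central h \<Longrightarrow> central (1 - h)"
  by (simp add: central_def algebra_simps)

lemma central_mult: "central h \<Longrightarrow> central k \<Longrightarrow> central (h * k)"
  unfolding central_def by (metis mult.assoc)

lemma commutant_star:
  assumes "c\<^sup>\<star> = c" "t \<in> commutant {c}"
  shows "t\<^sup>\<star> \<in> commutant {c}"
proof -
  have "c * t = t * c" using assms by (simp add: commutant_def)
  then have "(c * t)\<^sup>\<star> = (t * c)\<^sup>\<star>" by simp
  then show ?thesis using assms by (simp add: commutant_def star_mult)
qed

lemma projection_sum:
  assumes "finite M" "\<And>m. m \<in> M \<Longrightarrow> projection m" "pairwise (\<lambda>a b. a * b = 0) M"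
  shows "projection (\<Sum>M)"
proof -
  have "\<Sum>M * \<Sum>M = (\<Sum>a\<in>M. \<Sum>b\<in>M. a * b)" by (simp add: sum_product)
  also have "\<dots> = (\<Sum>a\<in>M. \<Sum>b\<in>M. if a = b then a else 0)"
    using assms by (intro sum.cong) (auto simp: pairwise_def projection_idem)
  also have "\<dots> = \<Sum>M" using assms(1) by (simp add: sum.delta)
  finally have "\<Sum>M * \<Sum>M = \<Sum>M" .
  moreover have "(\<Sum>M)\<^sup>\<star> = \<Sum>M" using assms(2) by (simp add: star_sum projection_star)
  ultimately show ?thesis by (simp add: projection_def)
qed

definition equivalent :: "'a \<Rightarrow> 'a \<Rightarrow> bool" where
  "equivalent p q \<longleftrightarrow> (\<exists>u. partial_isometry u \<and> u\<^sup>\<star> * u = p \<and> u * u\<^sup>\<star> = q)"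

lemma partial_isometry_initial: "partial_isometry w \<Longrightarrow> projection (w\<^sup>\<star> * w)"
  unfolding projection_def partial_isometry_def by (metis mult.assoc star_mult star_star)

lemma partial_isometry_final: "partial_isometry w \<Longrightarrow> projection (w * w\<^sup>\<star>)"
  unfolding projection_def partial_isometry_def by (metis mult.assoc star_mult star_star)

lemma partial_isometry_times_initial: "partial_isometry w \<Longrightarrow> w * (w\<^sup>\<star> * w) = w"
  by (simp add: partial_isometry_def mult.assoc)

lemma partial_isometry_star: "partial_isometry w \<Longrightarrow> partial_isometry (w\<^sup>\<star>)"
  unfolding partial_isometry_def by (metis mult.assoc star_mult star_star)

text \<open>The summands are the initial projections of the \<open>u\<^sub>i\<close>, and \<open>q\<close> is their common final projection:
  each \<open>u\<^sub>i\<close> maps its summand onto the model \<open>q\<close>.\<close>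

definition sum_of_copies :: "nat \<Rightarrow> 'a \<Rightarrow> 'a \<Rightarrow> bool" where
  "sum_of_copies n q h \<longleftrightarrow> (\<exists>u. (\<forall>i<n. u i * (u i)\<^sup>\<star> = q) \<and> (\<Sum>i<n. (u i)\<^sup>\<star> * u i) = h)"

lemma bicommutant_commutes: "y \<in> bicommutant {c} \<Longrightarrow> c * y = y * c"
  by (simp add: commutant_def)

text \<open>This is how (EP) yields partial isometries: if the right-hand side is a projection, then
  \<open>a y\<close> is a partial isometry and \<open>y\<close> acts as a local inverse of \<open>\<bar>a\<bar>\<close>.\<close>

lemma initial_of_bicommutant_multiple:
  assumes "y\<^sup>\<star> = y" "y \<in> bicommutant {a\<^sup>\<star> * a}"
  shows "(a * y)\<^sup>\<star> * (a * y) = (a\<^sup>\<star> * a) * y ^ 2"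
proof -
  have "(a * y)\<^sup>\<star> * (a * y) = (y * (a\<^sup>\<star> * a)) * y" using assms(1) by (simp add: star_mult mult.assoc)
  also have "y * (a\<^sup>\<star> * a) = a\<^sup>\<star> * a * y" using bicommutant_commutes[OF assms(2)] by simp
  finally show ?thesis by (simp add: power2_eq_square mult.assoc)
qed

end

section \<open>Annihilators and suprema of projections\<close>

text \<open>Zorn's lemma for orthogonal families of projections or of partial isometries.\<close>

lemma maximal_pairwise_subset:
  assumes "\<And>x y. r x y \<Longrightarrow> r y x"
  obtains M where "M \<subseteq> W" "pairwise r M" "\<And>w. w \<in> W \<Longrightarrow> (\<And>m. m \<in> M \<Longrightarrow> r w m) \<Longrightarrow> w \<in> M"
proof -
  define F where "F = {M. M \<subseteq> W \<and> pairwise r M}"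
  have "\<exists>M\<in>F. \<forall>X\<in>F. M \<subseteq> X \<longrightarrow> X = M"
  proof (rule subset_Zorn')
    fix C assume C: "subset.chain F C"
    then have "pairwise r (\<Union>C)"
      by (intro pairwise_chain_Union) (auto simp: F_def subset_chain_def chains_def chain_subset_def)
    then show "\<Union>C \<in> F"
      using C by (auto simp: F_def subset_chain_def)
  qed
  then obtain M where M: "M \<in> F" "\<And>X. X \<in> F \<Longrightarrow> M \<subseteq> X \<Longrightarrow> X = M" by blast
  show ?thesis
  proof (rule that)
    show "M \<subseteq> W" "pairwise r M" using M(1) by (auto simp: F_def)
    fix w assume "w \<in> W" and rw: "\<And>m. m \<in> M \<Longrightarrow> r w m"
    then have "insert w M \<in> F" using M(1) assms by (auto simp: F_def pairwise_insert)
    then show "w \<in> M" using M(2)[of "insert w M"] by auto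
  qed
qed

context baer_star_ring
begin

lemma annihilator_projection:
  obtains p where "projection p" "\<And>y. (\<forall>x\<in>S. x * y = 0) \<longleftrightarrow> p * y = y"
proof (cases "S = {}")
  case True
  then show ?thesis using that[of 1] by (simp add: projection_def)
next
  case False
  then obtain p where p: "projection p" "right_annihilator S = right_ideal_of p" using baer by blast
  have "(\<forall>x\<in>S. x * y = 0) \<longleftrightarrow> p * y = y" for y
  proof -
    have "(\<forall>x\<in>S. x * y = 0) \<longleftrightarrow> y \<in> right_ideal_of p"
      by (simp flip: p(2) add: right_annihilator_def)
    also have "\<dots> \<longleftrightarrow> p * y = y"
      unfolding right_ideal_of_def using projection_idem[OF p(1)]
      by (auto simp: mult.assoc[symmetric]) (metis)
    finally show ?thesis .
  qed
  then show ?thesis using that p(1) by blast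
qed

text \<open>The projection that generates the right annihilator of \<open>x\<^sup>\<star>\<close> fixes \<open>x\<close> and is killed by \<open>x\<^sup>\<star>\<close>.\<close>

lemma star_mult_self_eq_0:
  assumes "x\<^sup>\<star> * x = 0" shows "x = 0"
proof -
  obtain p where p: "projection p" "\<And>y. (\<forall>a\<in>{x\<^sup>\<star>}. a * y = 0) \<longleftrightarrow> p * y = y"
    using annihilator_projection[of "{x\<^sup>\<star>}"] by blast
  have "p * x = x" using p(2)[of x] assms by simp
  moreover have "x\<^sup>\<star> * p = 0" using p by (simp add: projection_idem)
  ultimately have "x\<^sup>\<star> = 0" using projection_star[OF p(1)] by (metis star_mult)
  then show ?thesis using star_star[of x] by simp
qed

text \<open>With \<open>e = w\<^sup>\<star> w\<close>, the element \<open>w - w e\<close> has square norm \<open>e - e - e + e = 0\<close>.\<close>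

lemma projection_imp_partial_isometry:
  assumes "projection (w\<^sup>\<star> * w)" shows "partial_isometry w"
proof -
  let ?e = "w\<^sup>\<star> * w"
  have "(w - w * ?e)\<^sup>\<star> * (w - w * ?e) = ?e - ?e * ?e - (?e * ?e - ?e * (?e * ?e))"
    by (simp only: star_diff star_mult star_star left_diff_distrib right_diff_distrib mult.assoc)
  also have "\<dots> = 0" by (simp only: projection_idem[OF assms] diff_self)
  finally have "w - w * ?e = 0" by (rule star_mult_self_eq_0)
  then show ?thesis by (simp add: partial_isometry_def mult.assoc)
qed

text \<open>The hypothesis says that the right ideal of \<open>g\<close> is also a left ideal; its adjoint gives
  \<open>g r g = g r\<close>.\<close>

lemma central_if_absorbs:
  assumes g: "projection g" and "\<And>r. g * (r * g) = r * g"
  shows "central g"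
  unfolding central_def
proof
  fix r
  have "(g * (r\<^sup>\<star> * g))\<^sup>\<star> = (r\<^sup>\<star> * g)\<^sup>\<star>" by (simp add: assms(2))
  then have "g * (r * g) = g * r"
    using projection_star[OF g] by (simp add: star_mult star_star mult.assoc)
  then show "g * r = r * g" using assms(2) by simp
qed

lemma annihilator_ideal_projection:
  assumes "\<And>s r. s \<in> S \<Longrightarrow> s * r \<in> S"
  obtains g where "projection g" "central g" "\<And>y. (\<forall>x\<in>S. x * y = 0) \<longleftrightarrow> g * y = y"
proof -
  obtain g where g: "projection g" "\<And>y. (\<forall>x\<in>S. x * y = 0) \<longleftrightarrow> g * y = y"
    using annihilator_projection[of S] by blast
  have ann: "x * g = 0" if "x \<in> S" for x using g(2)[of g] projection_idem[OF g(1)] that by simp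
  have "g * (r * g) = r * g" for r
    using g(2)[of "r * g"] ann assms by (metis mult.assoc)
  then show ?thesis using that central_if_absorbs g by blast
qed

text \<open>The complement of \<open>g\<close> is the central cover of \<open>a\<close>.\<close>

lemma annihilator_corners_projection:
  obtains g where "projection g" "central g" "\<And>y. (\<forall>r. a * r * y = 0) \<longleftrightarrow> g * y = y"
proof -
  obtain g where "projection g" "central g" "\<And>y. (\<forall>x\<in>range ((*) a). x * y = 0) \<longleftrightarrow> g * y = y"
    by (rule annihilator_ideal_projection[of "range ((*) a)"]) (auto simp: mult.assoc)
  then show ?thesis using that by auto
qed

lemma proj_sup_exists:
  assumes "\<And>q. q \<in> P \<Longrightarrow> projection q"
  obtains s where "is_proj_sup P s"
proof -
  obtain g where g: "projection g" "\<And>y. (\<forall>x\<in>P. x * y = 0) \<longleftrightarrow> g * y = y"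
    using annihilator_projection[of P] by blast
  have "q * g = 0" if "q \<in> P" for q using g(2)[of g] projection_idem[OF g(1)] that by simp
  moreover have "proj_le (1 - g) t" if "projection t" "\<forall>q\<in>P. proj_le q t" for t
    using g(2)[of "1 - t"] that by (auto simp: proj_le_def algebra_simps)
  ultimately have "is_proj_sup P (1 - g)"
    using projection_complement[OF g(1)] by (simp add: is_proj_sup_def proj_le_def algebra_simps)
  then show ?thesis using that by blast
qed

text \<open>The right annihilator of \<open>a\<close> is generated by a projection, which is then an upper bound of \<open>P\<close>.
  This is the way in which all infinite sums are computed below.\<close>

lemma proj_sup_annihilated:
  assumes s: "is_proj_sup P s" and P: "\<And>q. q \<in> P \<Longrightarrow> projection q \<and> a * q = 0"
  shows "a * s = 0"
proof -
  obtain g where g: "projection g" "\<And>y. (\<forall>x\<in>{a}. x * y = 0) \<longleftrightarrow> g * y = y"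
    using annihilator_projection[of "{a}"] by blast
  have "proj_le q g" if "q \<in> P" for q
    using P[OF that] g projection_le_sym[of q g] by (simp add: proj_le_def)
  then have "proj_le s g" using s g(1) by (simp add: is_proj_sup_def)
  then have "g * s = s"
    using projection_le_sym[of s g] s g(1) by (simp add: proj_le_def is_proj_sup_def)
  then show ?thesis using g(2)[of s] by simp
qed

text \<open>For \<open>a = t\<close> and for \<open>a = t\<^sup>\<star>\<close>, the element \<open>(1 - s) a\<close> kills every member of \<open>P\<close> and hence \<open>s\<close>.\<close>

lemma proj_sup_commute:
  assumes s: "is_proj_sup P s"
    and P: "\<And>q. q \<in> P \<Longrightarrow> projection q \<and> q * t = t * q \<and> q * t\<^sup>\<star> = t\<^sup>\<star> * q"
  shows "s * t = t * s"
proof -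
  have le: "q * s = q" if "q \<in> P" for q
    using s that by (auto simp: is_proj_sup_def proj_le_def)
  have sup: "projection s" using s by (simp add: is_proj_sup_def)
  have *: "(1 - s) * a * s = 0"
    if a: "\<And>q. q \<in> P \<Longrightarrow> q * a = a * q" for a
  proof (rule proj_sup_annihilated[OF s])
    fix q assume q: "q \<in> P"
    have "s * q = q" using le[OF q] P[OF q] sup projection_le_sym by blast
    then have "(1 - s) * q = 0" by (simp add: algebra_simps)
    then have "(1 - s) * a * q = 0" using a[OF q] by (metis mult.assoc mult_zero_left)
    then show "projection q \<and> (1 - s) * a * q = 0" using P q by blast
  qed
  have 1: "t * s = s * t * s" using *[of t] P by (simp add: algebra_simps)
  have "t\<^sup>\<star> * s = s * t\<^sup>\<star> * s" using *[of "t\<^sup>\<star>"] P by (simp add: algebra_simps)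
  moreover have "(t\<^sup>\<star> * s)\<^sup>\<star> = s * t" "(s * t\<^sup>\<star> * s)\<^sup>\<star> = s * t * s"
    by (simp_all only: star_mult star_star projection_star[OF sup] mult.assoc)
  ultimately have "s * t = s * t * s" by simp
  then show ?thesis using 1 by simp
qed

text \<open>If \<open>a R p = 0\<close>, then the central cover of \<open>a\<close> kills \<open>p\<close>.\<close>

lemma faithful_annihilator:
  assumes p: "faithful_projection p" and a: "\<And>r. a * r * p = 0"
  shows "a = 0"
proof -
  obtain g where g: "projection g" "central g" "\<And>y. (\<forall>r. a * r * y = 0) \<longleftrightarrow> g * y = y"
    using annihilator_corners_projection[of a] by blast
  have "(1 - g) * p = 0" using g(3)[of p] a by (simp add: algebra_simps)
  then have "1 - g = 0"
    using p central_complement[OF g(2)] projection_idem[OF projection_complement[OF g(1)]]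
    unfolding faithful_projection_def by blast
  then show ?thesis using g(3)[of 1] by (metis eq_iff_diff_eq_0 mult.right_neutral)
qed

text \<open>Since \<open>q\<close> is central in the corner of \<open>p\<close>, \<open>q R (p - q) = 0\<close>; so the central cover \<open>h\<close> of \<open>q\<close>
  kills \<open>p - q\<close> and cuts \<open>q\<close> out of \<open>p\<close>.\<close>

lemma abelian_projection_below:
  assumes p: "abelian_projection p" and q: "projection q" "q * p = q"
  obtains h where "projection h" "central h" "q = h * p"
proof -
  have pp: "projection p" and ab: "abelian_ring_on (corner p)"
    using p by (auto simp: abelian_projection_def)
  have pq: "p * q = q" using q pp projection_le_sym by blast
  have "q = p * q * p" using q pq by simp
  then have qc: "q \<in> corner p" unfolding corner_def by blast
  have z: "q * r * (p - q) = 0" for r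
  proof -
    have "p * r * p \<in> corner p" unfolding corner_def by blast
    then have "q * (p * r * p) = p * r * p * q"
      using ab qc projection_idem[OF q(1)] unfolding abelian_ring_on_def by blast
    then have "q * (p * r * p) * (p - q) = p * r * p * (q * (p - q))" by (simp add: mult.assoc)
    also have "q * (p - q) = 0" using q projection_idem[OF q(1)] by (simp add: algebra_simps)
    also have "q * (p * r * p) * (p - q) = (q * p) * r * (p * (p - q))" by (simp only: mult.assoc)
    also have "\<dots> = q * r * (p - q)"
      using q pq projection_idem[OF pp] by (simp add: right_diff_distrib)
    finally show ?thesis by simp
  qed
  obtain g where g: "projection g" "central g" "\<And>y. (\<forall>r. q * r * y = 0) \<longleftrightarrow> g * y = y"
    using annihilator_corners_projection[of q] by blast
  have "g * (p - q) = p - q" using g(3) z by blast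
  moreover have "q * 1 * g = 0" using g(3) projection_idem[OF g(1)] by blast
  moreover have "g * q = q * g" using g(2) by (simp add: central_def)
  ultimately have "q = (1 - g) * p" by (simp add: algebra_simps)
  then show ?thesis
    using that[of "1 - g"] projection_complement[OF g(1)] central_complement[OF g(2)] by blast
qed

text \<open>The projection onto the kernel of \<open>x\<close>: the generator of its right annihilator.\<close>

definition ker :: "'a \<Rightarrow> 'a" where
  "ker x = (SOME p. projection p \<and> (\<forall>y. x * y = 0 \<longleftrightarrow> p * y = y))"

lemma projection_ker: "projection (ker x)" and ker_iff: "x * y = 0 \<longleftrightarrow> ker x * y = y"
proof -
  have "\<exists>p. projection p \<and> (\<forall>y. x * y = 0 \<longleftrightarrow> p * y = y)"
    using annihilator_projection[of "{x}"] by auto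
  from someI_ex[OF this, folded ker_def] show "projection (ker x)" "x * y = 0 \<longleftrightarrow> ker x * y = y"
    by blast+
qed

lemma mult_ker: "x * ker x = 0"
  using ker_iff projection_idem[OF projection_ker] by blast

end

section \<open>Gluing partial isometries\<close>

locale finite_addable_baer_star_ring = baer_star_ring +
  assumes EP: EP and addable: axiom_A3 and finite_ring: finite_ring
begin

text \<open>The common core of the polar decomposition and of the comparison of projections: a maximal
  orthogonal family in \<open>W\<close>, glued to one partial isometry \<open>v\<close>.  The last clause is maximality,
  stated for \<open>v\<close> alone: no nonzero member of \<open>W\<close> is orthogonal to \<open>v\<close> on both sides.\<close>

lemma maximal_orthogonal_sum:
  assumes W: "\<And>w. w \<in> W \<Longrightarrow> partial_isometry w"
  shows "\<exists>v M. M \<subseteq> W \<and> partial_isometry v \<and>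
    is_proj_sup ((\<lambda>w. w\<^sup>\<star> * w) ` M) (v\<^sup>\<star> * v) \<and>
    is_proj_sup ((\<lambda>w. w * w\<^sup>\<star>) ` M) (v * v\<^sup>\<star>) \<and>
    (\<forall>w\<in>W. w * v\<^sup>\<star> = 0 \<longrightarrow> v\<^sup>\<star> * w = 0 \<longrightarrow> w = 0)"
proof -
  define r where "r = (\<lambda>a b::'a. (a\<^sup>\<star> * a) * (b\<^sup>\<star> * b) = 0 \<and> (a * a\<^sup>\<star>) * (b * b\<^sup>\<star>) = 0)"
  have "r b a" if "r a b" for a b
  proof -
    have "((a\<^sup>\<star> * a) * (b\<^sup>\<star> * b))\<^sup>\<star> = 0" "((a * a\<^sup>\<star>) * (b * b\<^sup>\<star>))\<^sup>\<star> = 0" using that by (simp_all add: r_def)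
    then show ?thesis by (simp only: r_def star_mult star_star simp_thms)
  qed
  then obtain M where M: "M \<subseteq> W" "pairwise r M"
    "\<And>w. w \<in> W \<Longrightarrow> (\<And>m. m \<in> M \<Longrightarrow> r w m) \<Longrightarrow> w \<in> M"
    using maximal_pairwise_subset[of r W] by blast
  have "\<forall>i\<in>M. partial_isometry i" using M(1) W by blast
  moreover have "\<forall>i\<in>M. \<forall>j\<in>M. i \<noteq> j \<longrightarrow> (i\<^sup>\<star> * i) * (j\<^sup>\<star> * j) = 0"
    "\<forall>i\<in>M. \<forall>j\<in>M. i \<noteq> j \<longrightarrow> (i * i\<^sup>\<star>) * (j * j\<^sup>\<star>) = 0"
    using M(2) by (auto simp: pairwise_def r_def)
  ultimately obtain v where v: "partial_isometry v"
    "is_proj_sup ((\<lambda>w. w\<^sup>\<star> * w) ` M) (v\<^sup>\<star> * v)"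
    "is_proj_sup ((\<lambda>w. w * w\<^sup>\<star>) ` M) (v * v\<^sup>\<star>)"
    using addable[unfolded axiom_A3_def, THEN spec[of _ M], THEN spec[of _ "\<lambda>x. x"]] by auto
  have le: "(m\<^sup>\<star> * m) * (v\<^sup>\<star> * v) = m\<^sup>\<star> * m" "(v\<^sup>\<star> * v) * (m\<^sup>\<star> * m) = m\<^sup>\<star> * m"
     "(v * v\<^sup>\<star>) * (m * m\<^sup>\<star>) = m * m\<^sup>\<star>" if m: "m \<in> M" for m
  proof -
    have pm: "partial_isometry m" using m M(1) W by blast
    show 1: "(m\<^sup>\<star> * m) * (v\<^sup>\<star> * v) = m\<^sup>\<star> * m"
      using v(2) m by (simp add: is_proj_sup_def proj_le_def)
    have 2: "(m * m\<^sup>\<star>) * (v * v\<^sup>\<star>) = m * m\<^sup>\<star>"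
      using v(3) m by (simp add: is_proj_sup_def proj_le_def)
    show "(v\<^sup>\<star> * v) * (m\<^sup>\<star> * m) = m\<^sup>\<star> * m" "(v * v\<^sup>\<star>) * (m * m\<^sup>\<star>) = m * m\<^sup>\<star>"
      using 1 2 projection_le_sym partial_isometry_initial partial_isometry_final pm v(1)
      by blast+
  qed
  have "w = 0" if w: "w \<in> W" "w * v\<^sup>\<star> = 0" "v\<^sup>\<star> * w = 0" for w
  proof -
    have w': "w\<^sup>\<star> * v = 0"
    proof -
      have "(v\<^sup>\<star> * w)\<^sup>\<star> = 0" using w(3) by simp
      then show ?thesis by (simp add: star_mult star_star)
    qed
    have "r w m" if m: "m \<in> M" for m
    proof -
      have "(w\<^sup>\<star> * w) * (m\<^sup>\<star> * m) = w\<^sup>\<star> * (w * v\<^sup>\<star>) * v * (m\<^sup>\<star> * m)"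
        using le(2)[OF m] by (simp add: mult.assoc)
      moreover have "(w * w\<^sup>\<star>) * (m * m\<^sup>\<star>) = w * (w\<^sup>\<star> * v) * v\<^sup>\<star> * (m * m\<^sup>\<star>)"
        using le(3)[OF m] by (simp add: mult.assoc)
      ultimately show ?thesis using w w' by (simp add: r_def)
    qed
    then have m: "w \<in> M" using M(3) w(1) by blast
    have "w = w * (w\<^sup>\<star> * w * (v\<^sup>\<star> * v))"
      using le(1)[OF m] partial_isometry_times_initial[OF W[OF w(1)]] by simp
    also have "\<dots> = w * w\<^sup>\<star> * (w * v\<^sup>\<star>) * v" by (simp add: mult.assoc)
    finally show ?thesis using w by simp
  qed
  then show ?thesis using M(1) v by blast
qed

lemma partial_isometry_multiple:
  assumes "a \<noteq> 0"
  obtains y where "partial_isometry (a * y)" "a * y \<noteq> 0" "\<And>e. a * e = a \<Longrightarrow> a * y * e = a * y"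
proof -
  obtain y where y: "y\<^sup>\<star> = y" "y \<in> bicommutant {a\<^sup>\<star> * a}"
    "projection ((a\<^sup>\<star> * a) * y ^ 2)" "(a\<^sup>\<star> * a) * y ^ 2 \<noteq> 0"
    using EP assms unfolding EP_def by blast
  note i = initial_of_bicommutant_multiple[OF y(1,2)]
  have pi: "partial_isometry (a * y)" using y(3) i projection_imp_partial_isometry by simp
  have nz: "a * y \<noteq> 0"
  proof
    assume "a * y = 0"
    then have "(a * y)\<^sup>\<star> * (a * y) = 0" by simp
    then show False using i y(4) by simp
  qed
  have "a * y * e = a * y" if e: "a * e = a" for e
  proof -
    have "a * y = a * y * (y ^ 2 * a\<^sup>\<star> * a)"
    proof -
      have "(a\<^sup>\<star> * a) * y ^ 2 = y ^ 2 * a\<^sup>\<star> * a"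
        using bicommutant_commutes[OF y(2)] unfolding power2_eq_square by (metis mult.assoc)
      then show ?thesis using partial_isometry_times_initial[OF pi] i by simp
    qed
    moreover have "a * y * (y ^ 2 * a\<^sup>\<star> * a) * e = a * y * (y ^ 2 * a\<^sup>\<star> * a)"
      using e by (simp add: mult.assoc)
    ultimately show ?thesis by simp
  qed
  then show ?thesis using that pi nz by blast
qed

text \<open>Adding \<open>1 - v\<^sup>\<star> v\<close> to \<open>v\<close> gives an isometry, to which finiteness applies.\<close>

lemma final_le_initial_imp_eq:
  assumes v: "partial_isometry v" and le: "(v\<^sup>\<star> * v) * (v * v\<^sup>\<star>) = v * v\<^sup>\<star>"
  shows "v * v\<^sup>\<star> = v\<^sup>\<star> * v"
proof -
  let ?s = "v\<^sup>\<star> * v"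
  have ps: "projection ?s" using partial_isometry_initial[OF v] .
  have vs: "v * ?s = v" using partial_isometry_times_initial[OF v] .
  have sv: "?s * v = v"
    using le vs by (metis mult.assoc)
  have vs': "v\<^sup>\<star> * ?s = v\<^sup>\<star>"
  proof -
    have "(?s * v)\<^sup>\<star> = v\<^sup>\<star>" using sv by simp
    then show ?thesis by (simp only: star_mult star_star)
  qed
  have sv': "?s * v\<^sup>\<star> = v\<^sup>\<star>"
  proof -
    have "(v * ?s)\<^sup>\<star> = v\<^sup>\<star>" using vs by simp
    then show ?thesis by (simp only: star_mult star_star)
  qed
  define t where "t = 1 - ?s"
  have t: "t\<^sup>\<star> = t" "t * t = t" "v * t = 0" "t * v = 0" "v\<^sup>\<star> * t = 0" "t * v\<^sup>\<star> = 0"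
    using projection_complement[OF ps] ps vs sv vs' sv' unfolding t_def
    by (simp_all add: projection_star projection_idem right_diff_distrib left_diff_distrib)
  have "(v + t)\<^sup>\<star> * (v + t) = 1"
    using t by (simp add: star_add distrib_left distrib_right) (simp add: t_def)
  then have "(v + t) * (v + t)\<^sup>\<star> = 1" using finite_ring by (simp add: finite_ring_def)
  then have "v * v\<^sup>\<star> + t = 1" using t by (simp add: star_add distrib_left distrib_right)
  then show ?thesis by (simp add: t_def)
qed

text \<open>With \<open>c = b\<^sup>\<star> b\<close>, the partial isometries \<open>b y\<close> that (EP) provides, \<open>y\<close> in the bicommutant of \<open>c\<close>,
  are pieces of the isometry in the polar decomposition of \<open>b\<close>.  Let \<open>v\<close> be the sum of a maximal
  orthogonal family of them and \<open>f = 1 - v\<^sup>\<star> v\<close>.  If \<open>b f\<close> were nonzero, (EP) for \<open>b f\<close> would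
  supply one more piece; here it matters that \<open>f\<close> lies in the bicommutant of \<open>c\<close>.  So \<open>b f = 0\<close>,
  \<open>f = 0\<close> by injectivity, and \<open>v\<close> is unitary by finiteness.  Now \<open>e\<close> kills every \<open>b y\<close>, hence
  \<open>v v\<^sup>\<star> = 1\<close>.\<close>

lemma right_injective_imp_left_injective:
  fixes b e :: 'a
  assumes inj: "\<And>y. b * y = 0 \<Longrightarrow> y = 0" and e: "e * b = 0"
  shows "e = 0"
proof -
  let ?c = "b\<^sup>\<star> * b"
  have cs: "?c\<^sup>\<star> = ?c" by (simp add: star_mult star_star)
  define Y where "Y = {y. y\<^sup>\<star> = y \<and> y \<in> bicommutant {?c} \<and> projection (?c * y ^ 2)}"
  define W where "W = (*) b ` Y"
  note i = initial_of_bicommutant_multiple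
  have pi: "partial_isometry w" if w: "w \<in> W" for w
  proof -
    obtain y where y: "y \<in> Y" "w = b * y" using w by (auto simp: W_def)
    then have "w\<^sup>\<star> * w = ?c * y ^ 2" using i[of y b] by (simp add: Y_def)
    then show ?thesis using y(1) projection_imp_partial_isometry by (simp add: Y_def)
  qed
  obtain v M where M: "M \<subseteq> W" and v: "partial_isometry v"
    and s1: "is_proj_sup ((\<lambda>w. w\<^sup>\<star> * w) ` M) (v\<^sup>\<star> * v)"
    and s2: "is_proj_sup ((\<lambda>w. w * w\<^sup>\<star>) ` M) (v * v\<^sup>\<star>)"
    and max: "\<forall>w\<in>W. w * v\<^sup>\<star> = 0 \<longrightarrow> v\<^sup>\<star> * w = 0 \<longrightarrow> w = 0"
    using maximal_orthogonal_sum[of W, OF pi] by blast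
  let ?g = "v\<^sup>\<star> * v"
  have pg: "projection ?g" using partial_isometry_initial[OF v] .
  have vg: "v * ?g = v" using partial_isometry_times_initial[OF v] .
  have comm: "?g * t = t * ?g" if t: "t \<in> commutant {?c}" for t
  proof (rule proj_sup_commute[OF s1])
    fix q assume "q \<in> (\<lambda>w. w\<^sup>\<star> * w) ` M"
    then obtain y where y: "y \<in> Y" "q = (b * y)\<^sup>\<star> * (b * y)" using M by (auto simp: W_def)
    then have q: "q = ?c * y ^ 2" using i[of y b] by (simp add: Y_def)
    have "q * a = a * q" if a: "a \<in> commutant {?c}" for a
    proof -
      have "a * y = y * a" using y(1) a by (auto simp: Y_def commutant_def)
      moreover have "?c * a = a * ?c" using a by (simp add: commutant_def)
      ultimately show ?thesis unfolding q power2_eq_square by (metis mult.assoc)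
    qed
    then show "projection q \<and> q * t = t * q \<and> q * t\<^sup>\<star> = t\<^sup>\<star> * q"
      using t commutant_star[OF cs t] y q by (simp add: Y_def)
  qed
  define f where "f = 1 - ?g"
  have pf: "projection f" using projection_complement[OF pg] by (simp add: f_def)
  have fbic: "f \<in> bicommutant {?c}"
    unfolding commutant_def[of "commutant _"] using comm by (simp add: f_def algebra_simps)
  have fc: "?c * f = f * ?c" using bicommutant_commutes[OF fbic] .
  have vf: "v * f = 0" using vg by (simp add: f_def right_diff_distrib)
  have fv: "f * v\<^sup>\<star> = 0"
  proof -
    have "(v * f)\<^sup>\<star> = 0" using vf by simp
    then show ?thesis using projection_star[OF pf] by (simp add: star_mult)
  qed
  have bf: "b * f = 0"
  proof (rule ccontr)
    let ?x = "b * f"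
    assume "?x \<noteq> 0"
    then obtain y where y: "y\<^sup>\<star> = y" "y \<in> bicommutant {?x\<^sup>\<star> * ?x}"
      "projection ((?x\<^sup>\<star> * ?x) * y ^ 2)" "(?x\<^sup>\<star> * ?x) * y ^ 2 \<noteq> 0"
      using EP unfolding EP_def by blast
    have xx: "?x\<^sup>\<star> * ?x = ?c * f"
      using fc projection_star[OF pf] projection_idem[OF pf] by (metis mult.assoc star_mult)
    have ybic: "y \<in> bicommutant {?c}"
    proof -
      \<comment> \<open>The bicommutant of \<open>c f\<close> is contained in that of \<open>c\<close> because
        \<open>f\<close> commutes with the commutant of \<open>c\<close>.\<close>
      have "commutant {?c} \<subseteq> commutant {?x\<^sup>\<star> * ?x}"
      proof
        fix t assume t: "t \<in> commutant {?c}"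
        then have "f * t = t * f" using comm by (simp add: f_def algebra_simps)
        moreover have "?c * t = t * ?c" using t by (simp add: commutant_def)
        ultimately have "?c * f * t = t * (?c * f)" by (metis mult.assoc)
        then show "t \<in> commutant {?x\<^sup>\<star> * ?x}" unfolding xx by (simp add: commutant_def)
      qed
      then show ?thesis using y(2) unfolding commutant_def by blast
    qed
    have fy: "f * y = y * f"
    proof -
      have "f \<in> commutant {?c}" using fc by (simp add: commutant_def)
      then show ?thesis using ybic by (auto simp: commutant_def)
    qed
    have yfbic: "y * f \<in> bicommutant {?c}"
      unfolding commutant_def[of "commutant _"]
    proof (intro CollectI ballI)
      fix t assume "t \<in> commutant {?c}"
      then have "t * y = y * t" "t * f = f * t"
        using ybic fbic unfolding commutant_def[of "commutant _"] by blast+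
      then show "t * (y * f) = y * f * t" by (metis mult.assoc)
    qed
    have yfs: "(y * f)\<^sup>\<star> = y * f" using fy y(1) projection_star[OF pf] by (simp add: star_mult)
    have yf2: "?c * (y * f) ^ 2 = (?x\<^sup>\<star> * ?x) * y ^ 2"
    proof -
      have "(y * f) ^ 2 = f * y ^ 2"
        unfolding power2_eq_square using fy projection_idem[OF pf] by (metis mult.assoc)
      then show ?thesis unfolding xx by (simp add: mult.assoc)
    qed
    define w where "w = b * (y * f)"
    have inY: "y * f \<in> Y" using yfs yfbic yf2 y(3) by (simp add: Y_def)
    have wW: "w \<in> W" using inY by (simp add: w_def W_def)
    have ww: "w\<^sup>\<star> * w = (?x\<^sup>\<star> * ?x) * y ^ 2" unfolding w_def using i[OF yfs yfbic] yf2 by simp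
    have wv: "w * v\<^sup>\<star> = 0" using fv by (simp add: w_def mult.assoc)
    \<comment> \<open>The final projections are orthogonal as well: \<open>w\<^sup>\<star> m\<close> has the factor \<open>m f\<close>,
      and \<open>f\<close> is orthogonal to the initial projection of \<open>m\<close>.\<close>
    have "w\<^sup>\<star> * (v * v\<^sup>\<star>) = 0"
    proof (rule proj_sup_annihilated[OF s2])
      fix q assume "q \<in> (\<lambda>w. w * w\<^sup>\<star>) ` M"
      then obtain m where m: "m \<in> M" "q = m * m\<^sup>\<star>" by auto
      then obtain y' where y': "y' \<in> Y" "m = b * y'" using M by (auto simp: W_def)
      have y'b: "y'\<^sup>\<star> = y'" "y' \<in> bicommutant {?c}" using y' by (auto simp: Y_def)
      have "y \<in> commutant {?c}" using bicommutant_commutes[OF ybic] by (simp add: commutant_def)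
      then have "y * y' = y' * y" using y'b(2) unfolding commutant_def[of "commutant _"] by blast
      have fy': "f * y' = y' * f"
        using fc y'b(2) unfolding commutant_def[of "commutant _"] by (auto simp: commutant_def)
      have "m * f = 0"
      proof -
        have "m\<^sup>\<star> * m * ?g = m\<^sup>\<star> * m" using s1 m(1) by (simp add: is_proj_sup_def proj_le_def)
        then have "m * (m\<^sup>\<star> * m) * ?g = m * (m\<^sup>\<star> * m)" by (metis mult.assoc)
        then have "m * ?g = m" using partial_isometry_times_initial[of m] pi M m(1) by auto
        then show ?thesis by (simp add: f_def right_diff_distrib)
      qed
      moreover have "w\<^sup>\<star> * m = y * (b\<^sup>\<star> * (m * f))"
      proof -
        have "w\<^sup>\<star> * m = y * (f * (b\<^sup>\<star> * (b * y')))"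
          using yfs fy unfolding w_def y'(2) by (simp add: star_mult mult.assoc)
        also have "f * (b\<^sup>\<star> * (b * y')) = b\<^sup>\<star> * (b * (y' * f))"
          using fc fy' by (metis mult.assoc)
        finally show ?thesis by (simp add: y'(2) mult.assoc)
      qed
      ultimately have "w\<^sup>\<star> * q = 0" using m(2) by (simp flip: mult.assoc)
      then show "projection q \<and> w\<^sup>\<star> * q = 0"
        using partial_isometry_final[of m] pi M m by auto
    qed
    then have "w\<^sup>\<star> * (v * v\<^sup>\<star> * v) = 0" by (simp flip: mult.assoc)
    then have "w\<^sup>\<star> * v = 0" using v by (simp add: partial_isometry_def)
    then have "(w\<^sup>\<star> * v)\<^sup>\<star> = 0" by simp
    then have "v\<^sup>\<star> * w = 0" by (simp add: star_mult star_star)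
    then have "w = 0" using max wW wv by blast
    then show False using ww y(4) by simp
  qed
  then have "?g = 1" using inj[of f] by (simp add: f_def)
  then have "v * v\<^sup>\<star> = 1" using finite_ring by (simp add: finite_ring_def)
  moreover have "e * (v * v\<^sup>\<star>) = 0"
  proof (rule proj_sup_annihilated[OF s2])
    fix q assume "q \<in> (\<lambda>w. w * w\<^sup>\<star>) ` M"
    then obtain m where m: "m \<in> M" "q = m * m\<^sup>\<star>" by auto
    then obtain y' where "y' \<in> Y" "m = b * y'" using M by (auto simp: W_def)
    then show "projection q \<and> e * q = 0"
      using partial_isometry_final[of m] pi M m e by (auto simp flip: mult.assoc)
  qed
  ultimately show ?thesis by simp
qed

text \<open>An infinite family would admit a shift \<open>g\<^sub>k \<mapsto> g\<^sub>k\<^sub>+\<^sub>1\<close>, glued from the partial isometries between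
  consecutive members; its final projection misses \<open>g\<^sub>0\<close>, against finiteness.\<close>

lemma infinite_equivalent_family_zero:
  assumes inf: "infinite E" and orth: "pairwise (\<lambda>a b. a * b = 0) E"
    and eq: "\<And>e. e \<in> E \<Longrightarrow> equivalent e q"
  shows "q = 0"
proof -
  obtain g :: "nat \<Rightarrow> 'a" where g: "inj g" "range g \<subseteq> E"
    using infinite_countable_subset[OF inf] by blast
  have "\<forall>k. \<exists>u. partial_isometry u \<and> u\<^sup>\<star> * u = g k \<and> u * u\<^sup>\<star> = q"
    using eq g(2) unfolding equivalent_def by blast
  then obtain u where u: "\<And>k. partial_isometry (u k)" "\<And>k. (u k)\<^sup>\<star> * u k = g k"
    "\<And>k. u k * (u k)\<^sup>\<star> = q" by metis
  have pgk: "projection (g k)" for k using partial_isometry_initial[OF u(1), of k] u(2) by simp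
  have qu: "q * u k = u k" for k using u(1)[of k] u(3)[of k] by (simp add: partial_isometry_def)
  define w where "w = (\<lambda>x. (u (Suc (inv g x)))\<^sup>\<star> * u (inv g x))"
  have wi: "(w (g k))\<^sup>\<star> * w (g k) = g k" for k
  proof -
    have "(w (g k))\<^sup>\<star> * w (g k) = (u k)\<^sup>\<star> * ((u (Suc k) * (u (Suc k))\<^sup>\<star>) * u k)"
      by (simp add: w_def g(1) star_mult star_star mult.assoc)
    then show ?thesis using u qu by simp
  qed
  have wf: "w (g k) * (w (g k))\<^sup>\<star> = g (Suc k)" for k
  proof -
    have "w (g k) * (w (g k))\<^sup>\<star> = (u (Suc k))\<^sup>\<star> * ((u k * (u k)\<^sup>\<star>) * u (Suc k))"
      by (simp add: w_def g(1) star_mult star_star mult.assoc)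
    then show ?thesis using u qu by simp
  qed
  have go: "g i * g j = 0" if "i \<noteq> j" for i j
    using orth g that unfolding pairwise_def inj_def by blast
  have "\<forall>i\<in>range g. partial_isometry (w i)"
    using wi pgk projection_imp_partial_isometry by auto
  moreover have "\<forall>i\<in>range g. \<forall>j\<in>range g. i \<noteq> j \<longrightarrow> ((w i)\<^sup>\<star> * w i) * ((w j)\<^sup>\<star> * w j) = 0"
    using wi go by (auto, metis)
  moreover have "\<forall>i\<in>range g. \<forall>j\<in>range g. i \<noteq> j \<longrightarrow> (w i * (w i)\<^sup>\<star>) * (w j * (w j)\<^sup>\<star>) = 0"
    using wf go by (auto, metis nat.inject)
  ultimately obtain v where v: "partial_isometry v"
    "is_proj_sup ((\<lambda>i. (w i)\<^sup>\<star> * w i) ` range g) (v\<^sup>\<star> * v)"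
    "is_proj_sup ((\<lambda>i. w i * (w i)\<^sup>\<star>) ` range g) (v * v\<^sup>\<star>)"
    using addable[unfolded axiom_A3_def, THEN spec[of _ "range g"], THEN spec[of _ w]] by blast
  have s: "g k * (v\<^sup>\<star> * v) = g k" for k
    using v(2) wi by (simp add: is_proj_sup_def proj_le_def)
  have s': "(v\<^sup>\<star> * v) * g k = g k" for k
    using s projection_le_sym pgk partial_isometry_initial[OF v(1)] by blast
  have "(1 - v\<^sup>\<star> * v) * (v * v\<^sup>\<star>) = 0"
    by (rule proj_sup_annihilated[OF v(3)]) (auto simp: wf pgk s' left_diff_distrib)
  then have "(v\<^sup>\<star> * v) * (v * v\<^sup>\<star>) = v * v\<^sup>\<star>" by (simp add: left_diff_distrib)
  then have "v * v\<^sup>\<star> = v\<^sup>\<star> * v" using final_le_initial_imp_eq v(1) by blast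
  moreover have "g 0 * (v * v\<^sup>\<star>) = 0"
    by (rule proj_sup_annihilated[OF v(3)]) (auto simp: wf pgk go)
  ultimately have "g 0 = 0" using s[of 0] by simp
  then have "u 0 = 0" using u(2)[of 0] star_mult_self_eq_0[of "u 0"] by simp
  then show ?thesis using u(3)[of 0] by simp
qed

text \<open>Glue a maximal orthogonal family of partial isometries in \<open>f R e\<close>.  What remains of \<open>e\<close> and \<open>f\<close>
  admits no further one, so by (EP) nothing nonzero is left between the remainders.\<close>

lemma comparison:
  assumes e: "projection e" and f: "projection f"
  obtains v where "partial_isometry v" "v * e = v" "f * v = v"
    "\<And>r. (f - v * v\<^sup>\<star>) * r * (e - v\<^sup>\<star> * v) = 0"
proof -
  define W where "W = {w. partial_isometry w \<and> w * e = w \<and> f * w = w}"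
  obtain v M where M: "M \<subseteq> W" and v: "partial_isometry v"
    and s1: "is_proj_sup ((\<lambda>w. w\<^sup>\<star> * w) ` M) (v\<^sup>\<star> * v)"
    and s2: "is_proj_sup ((\<lambda>w. w * w\<^sup>\<star>) ` M) (v * v\<^sup>\<star>)"
    and max: "\<forall>w\<in>W. w * v\<^sup>\<star> = 0 \<longrightarrow> v\<^sup>\<star> * w = 0 \<longrightarrow> w = 0"
    using maximal_orthogonal_sum[of W] by (auto simp: W_def)
  have piM: "partial_isometry m" "m * e = m" "f * m = m" if "m \<in> M" for m
    using that M by (auto simp: W_def)
  have "(1 - f) * (v * v\<^sup>\<star>) = 0"
  proof (rule proj_sup_annihilated[OF s2])
    fix q assume "q \<in> (\<lambda>w. w * w\<^sup>\<star>) ` M"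
    then show "projection q \<and> (1 - f) * q = 0"
      using piM by (auto simp: partial_isometry_final left_diff_distrib simp flip: mult.assoc)
  qed
  then have "f * (v * v\<^sup>\<star>) * v = v * v\<^sup>\<star> * v" by (simp add: left_diff_distrib)
  then have fv: "f * v = v" using v by (simp add: partial_isometry_def mult.assoc)
  have "(1 - e) * (v\<^sup>\<star> * v) = 0"
  proof (rule proj_sup_annihilated[OF s1])
    fix q assume "q \<in> (\<lambda>w. w\<^sup>\<star> * w) ` M"
    then obtain m where m: "m \<in> M" "q = m\<^sup>\<star> * m" by auto
    have "(m * e)\<^sup>\<star> = m\<^sup>\<star>" using piM(2)[OF m(1)] by simp
    then have "e * m\<^sup>\<star> = m\<^sup>\<star>" using projection_star[OF e] by (simp add: star_mult)
    then show "projection q \<and> (1 - e) * q = 0"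
      using piM m by (auto simp: partial_isometry_initial left_diff_distrib simp flip: mult.assoc)
  qed
  then have ei: "e * (v\<^sup>\<star> * v) = v\<^sup>\<star> * v" by (simp add: left_diff_distrib)
  then have "(v\<^sup>\<star> * v) * e = v\<^sup>\<star> * v" using projection_le_sym partial_isometry_initial[OF v] e by blast
  then have "v * (v\<^sup>\<star> * v) * e = v * (v\<^sup>\<star> * v)" by (metis mult.assoc)
  then have ve: "v * e = v" using partial_isometry_times_initial[OF v] by simp
  have "(f - v * v\<^sup>\<star>) * r * (e - v\<^sup>\<star> * v) = 0" for r
  proof (rule ccontr)
    let ?a = "(f - v * v\<^sup>\<star>) * r * (e - v\<^sup>\<star> * v)"
    assume "?a \<noteq> 0"
    then obtain y where y: "partial_isometry (?a * y)" "?a * y \<noteq> 0"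
      "\<And>e'. ?a * e' = ?a \<Longrightarrow> ?a * y * e' = ?a * y" using partial_isometry_multiple[of ?a] by metis
    have ee: "(e - v\<^sup>\<star> * v) * (e - v\<^sup>\<star> * v) = e - v\<^sup>\<star> * v" "(e - v\<^sup>\<star> * v) * e = e - v\<^sup>\<star> * v"
      using ei \<open>(v\<^sup>\<star> * v) * e = v\<^sup>\<star> * v\<close> projection_idem[OF e] projection_idem[OF partial_isometry_initial[OF v]]
      by (simp_all add: left_diff_distrib right_diff_distrib)
    have ey: "?a * y * e = ?a * y" "?a * y * (e - v\<^sup>\<star> * v) = ?a * y"
      by (rule y(3), simp add: mult.assoc ee)+
    have "f * (f - v * v\<^sup>\<star>) = f - v * v\<^sup>\<star>"
      using fv projection_idem[OF f] by (simp add: right_diff_distrib flip: mult.assoc)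
    then have "f * (?a * y) = ?a * y" by (simp flip: mult.assoc)
    then have W: "?a * y \<in> W" using y(1) ey(1) by (simp add: W_def)
    have evs: "(e - v\<^sup>\<star> * v) * v\<^sup>\<star> = 0"
    proof -
      have "(v * e)\<^sup>\<star> = v\<^sup>\<star>" "(v * (v\<^sup>\<star> * v))\<^sup>\<star> = v\<^sup>\<star>"
        using ve partial_isometry_times_initial[OF v] by simp_all
      then have "e * v\<^sup>\<star> = v\<^sup>\<star>" "v\<^sup>\<star> * v * v\<^sup>\<star> = v\<^sup>\<star>" using projection_star[OF e] by (simp_all add: star_mult star_star)
      then show ?thesis by (simp add: left_diff_distrib)
    qed
    have "?a * y * v\<^sup>\<star> = ?a * y * ((e - v\<^sup>\<star> * v) * v\<^sup>\<star>)"
      using ey(2) mult.assoc[of "?a * y" "e - v\<^sup>\<star> * v" "v\<^sup>\<star>"] by simp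
    then have 1: "?a * y * v\<^sup>\<star> = 0" using evs by simp
    have "v\<^sup>\<star> * (f - v * v\<^sup>\<star>) = 0"
    proof -
      have "(f * v)\<^sup>\<star> = v\<^sup>\<star>" "v\<^sup>\<star> * v * v\<^sup>\<star> = v\<^sup>\<star>"
        using fv partial_isometry_star[OF v] by (simp_all add: partial_isometry_def star_star)
      then show ?thesis using projection_star[OF f] by (simp add: star_mult right_diff_distrib mult.assoc)
    qed
    then have "v\<^sup>\<star> * (?a * y) = 0" by (simp flip: mult.assoc)
    then show False using max W 1 y(2) by blast
  qed
  then show ?thesis using that v ve fv by blast
qed

section \<open>Finite homogeneous central pieces\<close>

text \<open>Take a maximal orthogonal family \<open>M\<close> of copies of \<open>z p\<close> below \<open>z\<close>; it is finite.  Compare \<open>p\<close>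
  with the remainder \<open>f = z - \<Sum>M\<close>: the part of \<open>p\<close> that embeds in \<open>f\<close> is \<open>k p\<close> for a central \<open>k\<close>,
  as \<open>p\<close> is abelian.  By maximality not all of \<open>z p\<close> embeds, so \<open>h = z (1 - k)\<close> is nonzero.
  On \<open>h\<close> nothing of \<open>f\<close> is matched with \<open>p\<close>, so faithfulness of \<open>p\<close> gives \<open>h f = 0\<close>, and \<open>h\<close> is
  the sum of the copies \<open>h m\<close> of \<open>h p\<close>.\<close>

lemma exists_homogeneous_part:
  assumes ab: "abelian_projection p" and ff: "faithful_projection p"
    and z: "projection z" "central z" "z \<noteq> 0"
  obtains h n where "projection h" "central h" "h \<noteq> 0" "z * h = h" "sum_of_copies n (h * p) h"
proof -
  have p: "projection p" using ab by (simp add: abelian_projection_def)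
  have zp: "projection (z * p)" using projection_central_mult z p by blast
  have zc: "z * x = x * z" for x using z(2) by (simp add: central_def)
  have zz: "z * z = z" using projection_idem[OF z(1)] .
  have zp0: "z * p \<noteq> 0" using ff z zz unfolding faithful_projection_def by blast
  define P where "P = {q. projection q \<and> z * q = q \<and> equivalent q (z * p)}"
  obtain M where M: "M \<subseteq> P" "pairwise (\<lambda>a b. a * b = 0 \<and> b * a = 0) M"
    "\<And>q. q \<in> P \<Longrightarrow> (\<And>m. m \<in> M \<Longrightarrow> q * m = 0 \<and> m * q = 0) \<Longrightarrow> q \<in> M"
    using maximal_pairwise_subset[of "\<lambda>a b. a * b = 0 \<and> b * a = 0" P] by blast
  have MP: "projection m" "z * m = m" "equivalent m (z * p)" if "m \<in> M" for m
    using that M(1) by (auto simp: P_def)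
  have orth: "pairwise (\<lambda>a b. a * b = 0) M" using M(2) by (auto simp: pairwise_def)
  have fin: "finite M"
    using infinite_equivalent_family_zero[of M "z * p"] orth MP(3) zp0 by blast
  define f where "f = z - \<Sum>M"
  have pM: "projection (\<Sum>M)" using projection_sum fin MP(1) orth by blast
  have zM: "z * \<Sum>M = \<Sum>M" using MP(2) by (simp add: sum_distrib_left)
  have f: "projection f"
    using z(1) pM zM zc[of "\<Sum>M"] unfolding f_def projection_def by (simp add: algebra_simps)
  have fM: "f * m = 0" "m * f = 0" if m: "m \<in> M" for m
  proof -
    have "\<Sum>M * m = (\<Sum>a\<in>M. if a = m then m else 0)"
      unfolding sum_distrib_right using m orth MP(1)
      by (intro sum.cong) (auto simp: pairwise_def projection_idem)
    moreover have "m * \<Sum>M = (\<Sum>a\<in>M. if a = m then m else 0)"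
      unfolding sum_distrib_left using m orth MP(1)
      by (intro sum.cong) (auto simp: pairwise_def projection_idem)
    ultimately show "f * m = 0" "m * f = 0"
      using fin m MP(2)[OF m] zc[of m] by (simp_all add: f_def algebra_simps)
  qed
  obtain v where v: "partial_isometry v" "v * p = v" "f * v = v"
    "\<And>r. (f - v * v\<^sup>\<star>) * r * (p - v\<^sup>\<star> * v) = 0"
    using comparison[OF p f] by metis
  have "v\<^sup>\<star> * v * p = v\<^sup>\<star> * v" using v(2) by (simp add: mult.assoc)
  then obtain k where k: "projection k" "central k" "v\<^sup>\<star> * v = k * p"
    using abelian_projection_below[OF ab partial_isometry_initial[OF v(1)]] by metis
  have kc: "k * x = x * k" for x using k(2) by (simp add: central_def)
  have kk: "k * k = k" using projection_idem[OF k(1)] .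
  define h where "h = z * (1 - k)"
  have hc: "central h" unfolding h_def by (intro central_mult central_complement z(2) k(2))
  have hp: "projection h"
    using projection_central_mult z(1,2) projection_complement[OF k(1)] by (simp add: h_def)
  have zf: "z * f = f" using zz zM by (simp add: f_def right_diff_distrib)
  have h0: "h \<noteq> 0"
  proof
    assume "h = 0"
    then have "z * k = z" by (simp add: h_def right_diff_distrib)
    have "v\<^sup>\<star> * v = z * p"
    proof -
      have "z * v = v" using v(3) zf by (metis mult.assoc)
      then have "v\<^sup>\<star> * v = z * (v\<^sup>\<star> * v)" using zc by (metis mult.assoc)
      also have "\<dots> = z * k * p" using k(3) by (simp add: mult.assoc)
      finally show ?thesis using \<open>z * k = z\<close> by simp
    qed
    then have "equivalent (v * v\<^sup>\<star>) (z * p)"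
      unfolding equivalent_def using partial_isometry_star[OF v(1)] by (metis star_star)
    moreover have fvv: "f * (v * v\<^sup>\<star>) = v * v\<^sup>\<star>" using v(3) by (simp flip: mult.assoc)
    moreover have "z * (v * v\<^sup>\<star>) = v * v\<^sup>\<star>" using fvv zf by (metis mult.assoc)
    moreover have pv: "projection (v * v\<^sup>\<star>)" using partial_isometry_final[OF v(1)] .
    ultimately have inP: "v * v\<^sup>\<star> \<in> P" by (simp add: P_def)
    have fvv': "v * v\<^sup>\<star> * f = v * v\<^sup>\<star>" using fvv projection_le_sym pv f by blast
    \<comment> \<open>All of \<open>z p\<close> would embed in \<open>f\<close>, and its image would be one more copy orthogonal to \<open>M\<close>.\<close>
    have "v * v\<^sup>\<star> \<in> M"
    proof (rule M(3)[OF inP])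
      fix m assume m: "m \<in> M"
      have "v * v\<^sup>\<star> * m = v * v\<^sup>\<star> * (f * m)" using fvv' by (metis mult.assoc)
      moreover have "m * (v * v\<^sup>\<star>) = m * f * (v * v\<^sup>\<star>)" using fvv by (metis mult.assoc)
      ultimately show "v * v\<^sup>\<star> * m = 0 \<and> m * (v * v\<^sup>\<star>) = 0" using fM[OF m] by simp
    qed
    then have "v * v\<^sup>\<star> = 0" using fM fvv by metis
    then have "v = 0" using v(1) by (simp add: partial_isometry_def)
    then show False using zp0 \<open>v\<^sup>\<star> * v = z * p\<close> by simp
  qed
  have hk: "h * k = 0" using kk by (simp add: h_def left_diff_distrib right_diff_distrib mult.assoc)
  have zh: "z * h = h" using zz by (simp add: h_def flip: mult.assoc)
  have hx: "h * x = x * h" for x using hc by (simp add: central_def)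
  have hh: "h * h = h" using projection_idem[OF hp] .
  have hv: "h * v = 0"
  proof -
    have "v = v * k * p" using partial_isometry_times_initial[OF v(1)] k(3) by (simp add: mult.assoc)
    then have "h * v = v * (h * k) * p" using hx by (metis mult.assoc)
    then show ?thesis using hk by simp
  qed
  have "h * (f - v * v\<^sup>\<star>) = 0"
  proof (rule faithful_annihilator[OF ff])
    fix r
    have "h * (f - v * v\<^sup>\<star>) * r * (p - v\<^sup>\<star> * v) = h * ((f - v * v\<^sup>\<star>) * r * (p - v\<^sup>\<star> * v))"
      by (simp only: mult.assoc)
    then have "h * (f - v * v\<^sup>\<star>) * r * (p - v\<^sup>\<star> * v) = 0" using v(4) by simp
    moreover have "h * (f - v * v\<^sup>\<star>) * r * (v\<^sup>\<star> * v) = 0"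
    proof -
      have "h * (f - v * v\<^sup>\<star>) * r * (k * p) = (h * k) * (f - v * v\<^sup>\<star>) * r * p"
        using kc by (metis mult.assoc)
      then show ?thesis using hk k(3) by simp
    qed
    ultimately show "h * (f - v * v\<^sup>\<star>) * r * p = 0" by (simp add: right_diff_distrib[of _ p])
  qed
  then have "h * f = 0" using hv by (simp add: right_diff_distrib flip: mult.assoc)
  then have hsum: "h = (\<Sum>m\<in>M. h * m)"
    using zh hx[of z] by (simp add: f_def right_diff_distrib sum_distrib_left)
  have "\<forall>m\<in>M. \<exists>u. u * u\<^sup>\<star> = h * p \<and> u\<^sup>\<star> * u = h * m"
  proof
    fix m assume "m \<in> M"
    then obtain u where u: "u\<^sup>\<star> * u = m" "u * u\<^sup>\<star> = z * p" using MP(3) by (auto simp: equivalent_def)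
    have "(h * u) * (h * u)\<^sup>\<star> = h * (u * u\<^sup>\<star>)" "(h * u)\<^sup>\<star> * (h * u) = h * (u\<^sup>\<star> * u)"
      using hh hx projection_star[OF hp] by (metis mult.assoc star_mult)+
    then show "\<exists>u. u * u\<^sup>\<star> = h * p \<and> u\<^sup>\<star> * u = h * m"
      using u zh hx[of z] by (metis mult.assoc)
  qed
  then obtain u where u: "\<And>m. m \<in> M \<Longrightarrow> u m * (u m)\<^sup>\<star> = h * p" "\<And>m. m \<in> M \<Longrightarrow> (u m)\<^sup>\<star> * u m = h * m"
    by metis
  obtain g where g: "bij_betw g {..<card M} M" using ex_bij_betw_nat_finite[OF fin] by (auto simp: atLeast0LessThan)
  have "sum_of_copies (card M) (h * p) h"
    unfolding sum_of_copies_def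
  proof (intro exI conjI allI impI)
    fix i assume "i < card M"
    then show "(u \<circ> g) i * ((u \<circ> g) i)\<^sup>\<star> = h * p" using u(1) g by (auto simp: bij_betw_def)
  next
    have "(\<Sum>i<card M. ((u \<circ> g) i)\<^sup>\<star> * (u \<circ> g) i) = (\<Sum>m\<in>M. (u m)\<^sup>\<star> * u m)"
      using sum.reindex_bij_betw[OF g, of "\<lambda>m. (u m)\<^sup>\<star> * u m"] by simp
    also have "\<dots> = (\<Sum>m\<in>M. h * m)" using u(2) by (intro sum.cong) auto
    finally show "(\<Sum>i<card M. ((u \<circ> g) i)\<^sup>\<star> * (u \<circ> g) i) = h" using hsum by simp
  qed
  then show ?thesis using that hp hc h0 zh by blast
qed

text \<open>The \<open>w\<^sub>i\<close> are \<open>n + 1\<close> partial isometries with common initial projection \<open>q\<close> and orthogonal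
  final projections below \<open>h\<close>.  If \<open>q \<noteq> 0\<close>, some nonzero projection below \<open>p\<close>, of the form \<open>k p\<close>
  with \<open>k\<close> central, embeds in \<open>q\<close>, and then in every final projection.  Sending the \<open>n\<close> copies of
  \<open>h p\<close> that make up \<open>h\<close> to the last \<open>n\<close> of these maps \<open>k h\<close> isometrically into \<open>k h\<close>, orthogonally
  to the first one; finiteness forbids this.\<close>

lemma no_more_copies:
  assumes ab: "abelian_projection p" and ff: "faithful_projection p"
    and h: "projection h" "central h" and copies: "sum_of_copies n (h * p) h"
    and q: "projection q"
    and w: "\<And>i. i \<le> n \<Longrightarrow> (w i)\<^sup>\<star> * w i = q" "\<And>i. i \<le> n \<Longrightarrow> h * w i = w i"
      "\<And>i j. i \<le> n \<Longrightarrow> j \<le> n \<Longrightarrow> i \<noteq> j \<Longrightarrow> (w i)\<^sup>\<star> * w j = 0"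
  shows "q = 0"
proof (rule ccontr)
  assume "q \<noteq> 0"
  have p: "projection p" using ab by (simp add: abelian_projection_def)
  have hx: "h * x = x * h" for x using h(2) by (simp add: central_def)
  have hh: "h * h = h" using projection_idem[OF h(1)] .
  obtain r where "q * r * p \<noteq> 0" using faithful_annihilator[OF ff, of q] \<open>q \<noteq> 0\<close> by blast
  from partial_isometry_multiple[OF this] obtain y where
    y: "partial_isometry (q * r * p * y)" "q * r * p * y \<noteq> 0"
    "\<And>e. q * r * p * e = q * r * p \<Longrightarrow> q * r * p * y * e = q * r * p * y" by metis
  define s where "s = q * r * p * y"
  have s: "partial_isometry s" "s \<noteq> 0" using y by (simp_all add: s_def)
  have sp: "s * p = s" unfolding s_def by (rule y(3)) (simp add: mult.assoc projection_idem[OF p])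
  have qs: "q * s = s" unfolding s_def by (simp add: projection_idem[OF q] flip: mult.assoc)
  have "s\<^sup>\<star> * s * p = s\<^sup>\<star> * s" using sp by (simp add: mult.assoc)
  then obtain k where k: "projection k" "central k" "s\<^sup>\<star> * s = k * p"
    using abelian_projection_below[OF ab partial_isometry_initial[OF s(1)]] by metis
  have kx: "k * x = x * k" for x using k(2) by (simp add: central_def)
  define t where "t i = w i * s" for i
  have tt: "(t i)\<^sup>\<star> * t j = (if i = j then k * p else 0)" if "i \<le> n" "j \<le> n" for i j
  proof -
    have "(t i)\<^sup>\<star> * t j = s\<^sup>\<star> * ((w i)\<^sup>\<star> * w j) * s" by (simp add: t_def star_mult mult.assoc)
    also have "(w i)\<^sup>\<star> * w j = (if i = j then q else 0)" using w that by simp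
    finally show ?thesis using qs k(3) by (simp add: mult.assoc)
  qed
  have ti: "projection ((t i)\<^sup>\<star> * t i)" if "i \<le> n" for i
    using tt[OF that that] partial_isometry_initial[OF s(1)] k(3) by simp
  have kt: "k * t i = t i" if "i \<le> n" for i
  proof -
    have "t i = t i * (k * p)"
      using partial_isometry_times_initial[OF projection_imp_partial_isometry[OF ti[OF that]]]
        tt[OF that that] by simp
    also have "\<dots> = k * (t i * p)" using kx by (metis mult.assoc)
    also have "t i * p = t i" using sp by (simp add: t_def mult.assoc)
    finally show ?thesis by simp
  qed
  have ht: "h * t i = t i" if "i \<le> n" for i
    using w(2)[OF that] by (simp add: t_def flip: mult.assoc)
  obtain u where u: "\<And>i. i < n \<Longrightarrow> u i * (u i)\<^sup>\<star> = h * p" "(\<Sum>i<n. (u i)\<^sup>\<star> * u i) = h"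
    using copies unfolding sum_of_copies_def by blast
  have pu: "p * u i = u i" if i: "i < n" for i
  proof -
    have "partial_isometry ((u i)\<^sup>\<star>)"
      using projection_imp_partial_isometry[of "(u i)\<^sup>\<star>"] u(1)[OF i] projection_central_mult[OF h(2,1) p]
      by (simp add: star_star)
    then have "u i * (u i)\<^sup>\<star> * u i = u i"
      using partial_isometry_star[of "(u i)\<^sup>\<star>"] by (simp add: star_star partial_isometry_def)
    then have "u i = p * (h * u i)" using u(1)[OF i] hx by (metis mult.assoc)
    then show ?thesis using projection_idem[OF p] by (metis mult.assoc)
  qed
  define V where "V = (\<Sum>i<n. t (Suc i) * u i)"
  have "V\<^sup>\<star> * V = (\<Sum>i<n. \<Sum>j<n. ((u i)\<^sup>\<star> * (t (Suc i))\<^sup>\<star>) * (t (Suc j) * u j))"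
    by (simp add: V_def star_sum star_mult sum_product)
  also have "\<dots> = (\<Sum>i<n. \<Sum>j<n. if i = j then k * ((u i)\<^sup>\<star> * u i) else 0)"
  proof (intro sum.cong refl)
    fix i j assume ij: "i \<in> {..<n}" "j \<in> {..<n}"
    have "((u i)\<^sup>\<star> * (t (Suc i))\<^sup>\<star>) * (t (Suc j) * u j) = (u i)\<^sup>\<star> * ((t (Suc i))\<^sup>\<star> * t (Suc j)) * u j"
      by (simp add: mult.assoc)
    also have "\<dots> = (if i = j then (u i)\<^sup>\<star> * (k * p) * u j else 0)" using tt ij by simp
    also have "\<dots> = (if i = j then k * ((u i)\<^sup>\<star> * u i) else 0)"
    proof -
      have "(u i)\<^sup>\<star> * (k * p) * u i = k * ((u i)\<^sup>\<star> * (p * u i))" using kx by (metis mult.assoc)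
      then show ?thesis using pu ij by auto
    qed
    finally show "((u i)\<^sup>\<star> * (t (Suc i))\<^sup>\<star>) * (t (Suc j) * u j) = (if i = j then k * ((u i)\<^sup>\<star> * u i) else 0)" .
  qed
  also have "\<dots> = k * h" using u(2) by (simp add: sum.delta flip: sum_distrib_left)
  finally have VV: "V\<^sup>\<star> * V = k * h" .
  have kh: "projection (k * h)" using projection_central_mult k(1,2) h(1) by blast
  have V: "partial_isometry V" using VV kh projection_imp_partial_isometry by simp
  have "k * h * V = V"
  proof -
    have "k * h * (t (Suc i) * u i) = t (Suc i) * u i" if "i < n" for i
      using kt[of "Suc i"] ht[of "Suc i"] that by (metis Suc_leI mult.assoc)
    then show ?thesis by (simp add: V_def sum_distrib_left)
  qed
  then have "V\<^sup>\<star> * V * (V * V\<^sup>\<star>) = V * V\<^sup>\<star>" unfolding VV by (simp flip: mult.assoc)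
  then have VV': "V * V\<^sup>\<star> = k * h" using final_le_initial_imp_eq[OF V] VV by simp
  have "(t 0)\<^sup>\<star> * V = (\<Sum>i<n. ((t 0)\<^sup>\<star> * t (Suc i)) * u i)"
    by (simp add: V_def sum_distrib_left mult.assoc)
  also have "\<dots> = 0" using tt by (intro sum.neutral) simp
  finally have "(t 0)\<^sup>\<star> * (V * V\<^sup>\<star>) = 0" by (simp flip: mult.assoc)
  then have "(t 0)\<^sup>\<star> * (k * h) = 0" by (simp add: VV')
  moreover have "(k * h * t 0)\<^sup>\<star> = (t 0)\<^sup>\<star> * (k * h)" using projection_star[OF kh] star_mult by metis
  moreover have "k * h * t 0 = t 0" using kt[of 0] ht[of 0] by (simp add: mult.assoc)
  ultimately have "(t 0)\<^sup>\<star> = 0" by simp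
  then have "k * p = 0" using tt[of 0 0] by simp
  then have "s = 0" using k(3) star_mult_self_eq_0[of s] by simp
  then show False using s(2) by simp
qed

section \<open>Stabilisation of the kernels of powers\<close>

text \<open>Suppose \<open>h x\<^sup>n v \<noteq> 0\<close> and replace \<open>v\<close> by \<open>h v\<close>.  Modulo the kernel \<open>K\<^sub>j\<close> of \<open>x\<^sup>j\<close>,
  the element \<open>x\<^sup>n\<^sup>-\<^sup>j v\<close> is nonzero, since \<open>x\<^sup>j\<close>
  maps it to \<open>x\<^sup>n v\<close>; moreover it lies in \<open>K\<^sub>j\<^sub>+\<^sub>1\<close>.  So \<open>b\<^sub>j = (1 - K\<^sub>j) x\<^sup>n\<^sup>-\<^sup>j v\<close> for \<open>j \<le> n\<close> are nonzero with
  mutually orthogonal ranges.  By (EP) a right multiple of each \<open>b\<^sub>j\<close> is a nonzero partial isometry;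
  \<open>v\<close> and the partial isometries already found are shrunk along the way so that all of them
  have the same initial projection, contrary to \<open>no_more_copies\<close>.\<close>

lemma kernel_stabilizes:
  assumes ab: "abelian_projection p" and ff: "faithful_projection p"
    and h: "projection h" "central h" and copies: "sum_of_copies n (h * p) h"
    and v: "h * x ^ Suc n * v = 0"
  shows "h * x ^ n * v = 0"
proof (rule ccontr)
  have hx: "h * y = y * h" for y using h(2) by (simp add: central_def)
  have hh: "h * h = h" using projection_idem[OF h(1)] .
  define K where "K j = ker (x ^ j)" for j
  have pK: "projection (K j)" for j by (simp add: K_def projection_ker)
  have K: "x ^ j * y = 0 \<longleftrightarrow> K j * y = y" for j y by (simp add: K_def ker_iff)
  have xK: "x ^ j * K j = 0" for j by (simp add: K_def mult_ker)
  have KK: "K j * K i = K i" if "i \<le> j" for i j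
  proof -
    have "x ^ j * K i = x ^ (j - i) * (x ^ i * K i)"
      using that by (simp flip: mult.assoc power_add)
    then show ?thesis using K[of j "K i"] xK by simp
  qed
  \<comment> \<open>State of the construction after \<open>j\<close> steps: \<open>u\<close> is the shrunk \<open>v\<close>, and \<open>x\<^sup>n u\<close> is still injective on \<open>q\<close>,
    the common initial projection of the partial isometries \<open>w\<^sub>i\<close> found so far.\<close>
  define P where "P j q u w \<longleftrightarrow> projection q \<and> q \<noteq> 0 \<and> u * q = u \<and> x ^ Suc n * u = 0 \<and> h * u = u \<and>
    (\<forall>r. x ^ n * u * r = 0 \<longrightarrow> q * r = 0) \<and>
    (\<forall>i<j. (w i)\<^sup>\<star> * w i = q \<and> K i * w i = 0 \<and> K (Suc i) * w i = w i \<and> h * w i = w i)"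
    for j :: nat and q u and w :: "nat \<Rightarrow> 'a"
  assume nz: "h * x ^ n * v \<noteq> 0"
  have "\<exists>q u w. P j q u w" if "j \<le> Suc n" for j
    using that
  proof (induction j)
    case 0
    define a where "a = x ^ n * (h * v)"
    define q where "q = 1 - ker a"
    have a0: "a \<noteq> 0" using nz hx by (metis a_def mult.assoc)
    have aq: "a * q = a" by (simp add: q_def right_diff_distrib mult_ker)
    have pq: "projection q" using projection_complement projection_ker by (simp add: q_def)
    have "q * r = 0" if "x ^ n * (h * v * q) * r = 0" for r
    proof -
      have "a * r = 0" using that aq by (simp add: a_def flip: mult.assoc)
      then show ?thesis using ker_iff by (simp add: q_def left_diff_distrib)
    qed
    moreover have "x ^ Suc n * (h * v * q) = 0"
      using v hx by (metis mult.assoc mult_zero_left)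
    moreover have "h * (h * v * q) = h * v * q" using hh by (simp flip: mult.assoc)
    moreover have "h * v * q * q = h * v * q" using projection_idem[OF pq] by (simp add: mult.assoc)
    moreover have "q \<noteq> 0" using a0 aq by auto
    ultimately have "P 0 q (h * v * q) w" for w using pq by (simp add: P_def)
    then show ?case by blast
  next
    case (Suc j)
    then obtain q u w where "P j q u w" by auto
    then have q: "projection q" "q \<noteq> 0" and u: "u * q = u" "x ^ Suc n * u = 0" "h * u = u"
      and inj: "\<And>r. x ^ n * u * r = 0 \<Longrightarrow> q * r = 0"
      and w: "\<And>i. i < j \<Longrightarrow> (w i)\<^sup>\<star> * w i = q" "\<And>i. i < j \<Longrightarrow> K i * w i = 0"
        "\<And>i. i < j \<Longrightarrow> K (Suc i) * w i = w i" "\<And>i. i < j \<Longrightarrow> h * w i = w i"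
      unfolding P_def by blast+
    have jn: "j \<le> n" using Suc.prems by simp
    define b where "b = (1 - K j) * (x ^ (n - j) * u)"
    have xx: "x ^ j * (x ^ (n - j) * y) = x ^ n * y" for y
      using jn by (simp flip: mult.assoc power_add)
    have b0: "b \<noteq> 0"
    proof
      assume "b = 0"
      then have "x ^ j * (x ^ (n - j) * u) = 0" using K by (simp add: b_def left_diff_distrib)
      then have "x ^ n * u * q = 0" using xx by simp
      then show False using inj q projection_idem by metis
    qed
    have bq: "b * q = b" using u(1) by (simp add: b_def mult.assoc)
    obtain y where y: "partial_isometry (b * y)" "b * y \<noteq> 0" "b * y * q = b * y"
      using partial_isometry_multiple[OF b0] bq by metis
    define c where "c = b * y"
    define q' where "q' = c\<^sup>\<star> * c"
    have q': "projection q'" "q' \<noteq> 0"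
      using y(1,2) partial_isometry_initial[of c] star_mult_self_eq_0[of c] unfolding q'_def c_def by blast+
    have q'q: "q' * q = q'" using y(3) by (simp add: q'_def c_def mult.assoc)
    have qq': "q * q' = q'" using q'q projection_le_sym q'(1) q(1) by blast
    define w' where "w' i = (if i < j then w i * q' else c)" for i
    have Kb: "K j * b = 0" using projection_idem[OF pK] by (simp add: b_def left_diff_distrib right_diff_distrib flip: mult.assoc)
    have "x ^ Suc j * b = 0"
    proof -
      have "x ^ Suc j * b = x * (x ^ j * (x ^ (n - j) * u)) - x * ((x ^ j * K j) * (x ^ (n - j) * u))"
        by (simp add: b_def left_diff_distrib right_diff_distrib mult.assoc)
      then show ?thesis using xx xK u(2) by (simp add: mult.assoc)
    qed
    then have KSb: "K (Suc j) * b = b" using K by blast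
    have hb: "h * b = b"
    proof -
      have "h * b = (1 - K j) * (x ^ (n - j) * (h * u))" unfolding b_def using hx by (metis mult.assoc)
      then show ?thesis using u(3) by (simp add: b_def)
    qed
    have "(w' i)\<^sup>\<star> * w' i = q' \<and> K i * w' i = 0 \<and> K (Suc i) * w' i = w' i \<and> h * w' i = w' i"
      if "i < Suc j" for i
    proof (cases "i < j")
      case True
      have "(w i * q')\<^sup>\<star> * (w i * q') = q' * (((w i)\<^sup>\<star> * w i) * q')"
        using projection_star[OF q'(1)] by (simp add: star_mult mult.assoc)
      then have "(w i * q')\<^sup>\<star> * (w i * q') = q'" using w(1)[OF True] qq' projection_idem[OF q'(1)] by simp
      then show ?thesis using True w by (simp add: w'_def flip: mult.assoc)
    next
      case False
      then have "i = j" using that by simp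
      then show ?thesis using Kb KSb hb by (simp add: w'_def c_def q'_def flip: mult.assoc)
    qed
    moreover have "q' * r = 0" if "x ^ n * (u * q') * r = 0" for r
    proof -
      have "q * (q' * r) = 0" using inj[of "q' * r"] that by (simp add: mult.assoc)
      then show ?thesis using qq' by (simp flip: mult.assoc)
    qed
    moreover have "x ^ Suc n * (u * q') = 0" using u(2) by (metis mult.assoc mult_zero_left)
    moreover have "h * (u * q') = u * q'" using u(3) by (simp flip: mult.assoc)
    moreover have "u * q' * q' = u * q'" using projection_idem[OF q'(1)] by (simp add: mult.assoc)
    ultimately have "P (Suc j) q' (u * q') w'" using q' by (simp add: P_def)
    then show ?case by blast
  qed
  then obtain q u w where "P (Suc n) q u w" by blast
  then have q: "projection q" "q \<noteq> 0"
    and w: "\<And>i. i \<le> n \<Longrightarrow> (w i)\<^sup>\<star> * w i = q" "\<And>i. i \<le> n \<Longrightarrow> K i * w i = 0"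
      "\<And>i. i \<le> n \<Longrightarrow> K (Suc i) * w i = w i" "\<And>i. i \<le> n \<Longrightarrow> h * w i = w i"
    unfolding P_def less_Suc_eq_le by blast+
  have lt: "(w i)\<^sup>\<star> * w j = 0" if "i < j" "j \<le> n" for i j
  proof -
    have "K j * w i = w i" using KK[of "Suc i" j] w(3)[of i] that by (metis Suc_leI less_imp_le mult.assoc order_trans)
    then have "(w i)\<^sup>\<star> = (w i)\<^sup>\<star> * K j" using projection_star[OF pK] star_mult by metis
    then have "(w i)\<^sup>\<star> * w j = (w i)\<^sup>\<star> * (K j * w j)" by (metis mult.assoc)
    then show ?thesis using w(2) that by simp
  qed
  have "(w i)\<^sup>\<star> * w j = 0" if "i \<le> n" "j \<le> n" "i \<noteq> j" for i j
  proof (cases "i < j")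
    case False
    then have "((w j)\<^sup>\<star> * w i)\<^sup>\<star> = 0" using lt that by simp
    then show ?thesis by (simp add: star_mult star_star)
  qed (use lt that in blast)
  then have "q = 0" using no_more_copies[OF ab ff h copies q(1), of w] w by blast
  then show False using q by simp
qed

section \<open>The projection onto the generalised kernel\<close>

text \<open>The elements killed by all homogeneous parts form the right ideal of a central projection, and
  a nonzero one would contain a homogeneous part.\<close>

lemma homogeneous_parts_cover:
  assumes ab: "abelian_projection p" and ff: "faithful_projection p"
    and y: "\<And>h n. projection h \<Longrightarrow> central h \<Longrightarrow> sum_of_copies n (h * p) h \<Longrightarrow> h * y = 0"
  shows "y = 0"
proof -
  define Z where "Z = {h. projection h \<and> central h \<and> (\<exists>n. sum_of_copies n (h * p) h)}"
  obtain g where g: "projection g" "\<And>y. (\<forall>h\<in>Z. h * y = 0) \<longleftrightarrow> g * y = y"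
    using annihilator_projection[of Z] by blast
  have Zg: "h * g = 0" if "h \<in> Z" for h using g(2)[of g] projection_idem[OF g(1)] that by simp
  have "h * (r * g) = 0" if "h \<in> Z" for h r
  proof -
    have "h * r = r * h" using that by (simp add: Z_def central_def)
    then have "h * (r * g) = r * (h * g)" by (metis mult.assoc)
    then show ?thesis using Zg[OF that] by simp
  qed
  then have "g * (r * g) = r * g" for r using g(2) by blast
  then have gc: "central g" using central_if_absorbs g(1) by blast
  have "g = 0"
  proof (rule ccontr)
    assume "g \<noteq> 0"
    then obtain h n where h: "projection h" "central h" "h \<noteq> 0" "g * h = h" "sum_of_copies n (h * p) h"
      using exists_homogeneous_part[OF ab ff g(1) gc] by metis
    have "g * h = h * g" using gc unfolding central_def by blast
    moreover have "h * g = 0" using Zg[of h] h unfolding Z_def by blast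
    ultimately show False using h by simp
  qed
  then show ?thesis using g(2)[of y] y by (auto simp: Z_def)
qed

text \<open>The summand is the projection \<open>s\<close> onto the generalised kernel of \<open>x\<close>.  Injectivity of \<open>x - s\<close> is
  checked on each homogeneous part \<open>h\<close>, where the kernels of the powers of \<open>x\<close> have stabilised,
  so that \<open>x\<^sup>n\<close> kills \<open>h s\<close> for some \<open>n\<close>.\<close>

lemma almost_star_clean_if_type_I:
  assumes ab: "abelian_projection p" and ff: "faithful_projection p"
  shows almost_star_clean
  unfolding almost_star_clean_def
proof
  fix x
  define K where "K j = ker (x ^ j)" for j
  have pK: "projection (K j)" for j by (simp add: K_def projection_ker)
  have K: "x ^ j * y = 0 \<longleftrightarrow> K j * y = y" for j y by (simp add: K_def ker_iff)
  have xK: "x ^ j * K j = 0" for j by (simp add: K_def mult_ker)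
  obtain s where s: "is_proj_sup (range K) s" using proj_sup_exists[of "range K"] pK by blast
  have ps: "projection s" and Ks: "K j * s = K j" for j
    using s by (auto simp: is_proj_sup_def proj_le_def)
  have sK: "s * K j = K j" for j using Ks projection_le_sym pK ps by blast
  have inj: "v = 0" if v: "(x - s) * v = 0" for v
  proof (rule homogeneous_parts_cover[OF ab ff])
    fix h n assume h: "projection h" "central h" "sum_of_copies n (h * p) h"
    have hx: "h * y = y * h" for y using h(2) by (simp add: central_def)
    have stable: "h * x ^ n * y = 0" if "h * x ^ Suc n * y = 0" for y
      using kernel_stabilizes[OF ab ff h that] .
    have "h * x ^ n * y = 0" if "h * x ^ (n + j) * y = 0" for j y
      using that
    proof (induction j arbitrary: y)
      case (Suc j)
      have "h * x ^ Suc n * (x ^ j * y) = h * x ^ (n + Suc j) * y"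
        by (simp add: power_add mult.assoc)
      then have "h * x ^ n * (x ^ j * y) = 0" using stable Suc.prems by simp
      then have "h * x ^ (n + j) * y = 0" by (simp add: power_add mult.assoc)
      then show ?case by (rule Suc.IH)
    qed simp
    then have hK: "h * x ^ n * K j = 0" for j
      using xK[of j] by (metis add.commute mult.assoc mult_zero_right power_add)
    have hs: "h * x ^ n * s = 0"
      by (rule proj_sup_annihilated[OF s]) (auto simp: pK hK)
    define v' where "v' = h * v"
    have xv: "x * v' = s * v'"
      using v hx unfolding v'_def by (metis eq_iff_diff_eq_0 left_diff_distrib mult.assoc)
    have hv: "h * v' = v'" using projection_idem[OF h(1)] by (simp add: v'_def flip: mult.assoc)
    have "h * x ^ Suc n * v' = h * x ^ n * (x * v')" by (simp only: power_Suc2 mult.assoc)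
    then have "h * x ^ Suc n * v' = h * x ^ n * s * v'" by (simp only: xv mult.assoc)
    then have "h * x ^ n * v' = 0" using stable hs by simp
    then have xnv: "x ^ n * v' = 0" using hv hx by (metis mult.assoc)
    \<comment> \<open>\<open>x\<close> maps \<open>v'\<close> into the kernel of \<open>x\<^sup>n\<close>, so \<open>v'\<close> itself lies
      in that kernel, on which \<open>s\<close> is the identity.\<close>
    then have "K n * v' = v'" using K by blast
    then have "s * v' = v'" using sK[of n] by (metis mult.assoc)
    then have "x * v' = v'" using xv by simp
    then have "x ^ j * v' = v'" for j by (induction j) (simp_all add: mult.assoc)
    then show "h * v = 0" using xnv by (simp add: v'_def)
  qed
  have "regular_element (x - s)"
    unfolding regular_element_def left_zero_divisor_def right_zero_divisor_def
    using inj right_injective_imp_left_injective[of "x - s"] by blast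
  moreover have "x = (x - s) + s" by simp
  ultimately show "\<exists>u p. regular_element u \<and> projection p \<and> x = u + p" using ps by blast
qed

end

lemma regular_element_is_unit:
  fixes u :: "'a::{ring,monoid_mult}"
  assumes "von_neumann_regular_on (UNIV :: 'a set)" and u: "regular_element u"
  shows "ring_unit u"
proof -
  obtain y where y: "u * y * u = u" using assms(1) unfolding von_neumann_regular_on_def by blast
  have "u * (y * u - 1) = 0" "(u * y - 1) * u = 0"
    using y by (simp_all add: left_diff_distrib right_diff_distrib mult.assoc)
  then have "y * u = 1" "u * y = 1"
    using u unfolding regular_element_def left_zero_divisor_def right_zero_divisor_def
    by (metis eq_iff_diff_eq_0)+
  then show ?thesis unfolding invertible_on_def by blast
qed

theorem theorem12:
  fixes star :: "'a::{ring,monoid_mult} \<Rightarrow> 'a"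
  assumes "baer_star_ring star"
    and "star_ring.type_I_f star"
    and "star_ring.axiom_A2 star"
    and "star_ring.axiom_A3 star"
    and "star_ring.axiom_A4 star"
    and "star_ring.axiom_A5 star"
    and "star_ring.axiom_A6 star"
  shows "star_ring.almost_star_clean star \<and>
    (von_neumann_regular_on (UNIV :: 'a set) \<longrightarrow> star_ring.star_clean star)"
proof -
  interpret baer_star_ring star by fact
  interpret finite_addable_baer_star_ring star
    using assms(2-4) by unfold_locales (auto simp: axiom_A2_def type_I_f_def)
  obtain p where "abelian_projection p" "faithful_projection p"
    using assms(2) by (auto simp: type_I_f_def type_I_def)
  then have clean: almost_star_clean by (rule almost_star_clean_if_type_I)
  moreover have star_clean if "von_neumann_regular_on (UNIV :: 'a set)"
    unfolding star_clean_def
    using clean[unfolded almost_star_clean_def] regular_element_is_unit[OF that] by blast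
  ultimately show ?thesis by blast
qed

end
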